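(* (i) The word problem of the identity $(CD)$: $x(yz)=(xy)(yz)$ is decidable, and even primitive recursive: there is a primitive recursive algorithm which, given two terms $t,t'$ in $T_\infty$, decides whether $t=_{CD}t'$ holds. (ii) Let $G$ be the group $\langle \{g_\alpha : \alpha\in\mathbf{A}\}\ ;\ R_{CD}\rangle$, let $G_0$ be the subgroup of $G$ generated by all elements $g_{0\alpha}$ with $\alpha\in\mathbf{A}$, and let $\mathrm{sh}_1$ be the endomorphism of $G$ that maps $g_\alpha$ to $g_{1\alpha}$ for every $\alpha\in\mathbf{A}$. Then the operation $*$ defined on $G$ by $$a*b=a\cdot \mathrm{sh}_1(b)\cdot g_{\emptyset}\cdot \mathrm{sh}_1(b^{-1})$$ induces a well-defined operation on the set of cosets $\{aG_0 : a\in G\}$; the latter operation satisfies Identity $(CD)$, and every monogenic subsystem of this coset set (i.e. every subsystem generated by a single element) is a free CD-system.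
   Context: A CD-system is a set with a binary operation satisfying $x(yz)=(xy)(yz)$. $T_\infty$ is the set of all well-formed terms built from variables $x_1,x_2,\dots$ and one binary operator $\cdot$. The relation $=_{CD}$ is the congruence on $T_\infty$ generated by all pairs $(t_0\cdot(t_1\cdot t_2),\,(t_0\cdot t_1)\cdot(t_1\cdot t_2))$. $\mathbf{A}$ is the set of all finite sequences of $0$'s and $1$'s (addresses), including the empty sequence $\emptyset$; $\gamma 0\alpha$ etc. denotes concatenation of sequences. $R_{CD}$ is the following family of relations, for all $\alpha,\beta,\gamma\in\mathbf{A}$: - $g_{\gamma0\alpha}\,g_{\gamma1\beta}=g_{\gamma1\beta}\,g_{\gamma0\alpha}$; - $g_{\gamma0\alpha}\,g_{\gamma}=g_{\gamma}\,g_{\gamma00\alpha}$; - $g_{\gamma10\alpha}\,g_\gamma=g_\gamma\,g_{\gamma01\alpha}\,g_{\gamma10\alpha}$; - $g_{\gamma11\alpha}\,g_\gamma=g_\gamma\,g_{\gamma11\alpha}$; - $g_{\gamma1}\,g_\gamma\,g_{\gamma0}=g_\gamma\,g_{\gamma1}\,g_\gamma$. *)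

theory Defs
  imports "HOL-Algebra.Left_Coset" "HOL-Algebra.Generated_Groups" "HOL-Library.Nat_Bijection"
begin

section \<open>CD-systems\<close>

text \<open>Operations are total functions; only their restriction to the carrier matters.\<close>

definition cd_system :: "'a set \<Rightarrow> ('a \<Rightarrow> 'a \<Rightarrow> 'a) \<Rightarrow> bool" where
  "cd_system S op \<longleftrightarrow>
     (\<forall>x\<in>S. \<forall>y\<in>S. op x y \<in> S) \<and>
     (\<forall>x\<in>S. \<forall>y\<in>S. \<forall>z\<in>S. op x (op y z) = op (op x y) (op y z))"

definition cd_hom ::
  "'a set \<Rightarrow> ('a \<Rightarrow> 'a \<Rightarrow> 'a) \<Rightarrow> 'b set \<Rightarrow> ('b \<Rightarrow> 'b \<Rightarrow> 'b) \<Rightarrow> ('a \<Rightarrow> 'b) set" where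
  "cd_hom S op T op' = {h \<in> S \<rightarrow> T. \<forall>x\<in>S. \<forall>y\<in>S. h (op x y) = op' (h x) (h y)}"

inductive_set cd_generate :: "('a \<Rightarrow> 'a \<Rightarrow> 'a) \<Rightarrow> 'a set \<Rightarrow> 'a set"
  for op :: "'a \<Rightarrow> 'a \<Rightarrow> 'a" and B :: "'a set" where
  incl: "x \<in> B \<Longrightarrow> x \<in> cd_generate op B"
| closed: "\<lbrakk>x \<in> cd_generate op B; y \<in> cd_generate op B\<rbrakk> \<Longrightarrow> op x y \<in> cd_generate op B"

text \<open>
  The universal property of a free CD-system with basis \<open>B\<close>. HOL cannot quantify over
  types inside a formula, so the target systems live on subsets of a type \<open>'b\<close> passed as an
  argument; a theorem in which \<open>'b\<close> is a type variable covers all targets. The restriction to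
  \<open>extensional S\<close> makes uniqueness mean uniqueness on \<open>S\<close>.
\<close>

definition free_cd_system_on ::
  "'b itself \<Rightarrow> 'a set \<Rightarrow> ('a \<Rightarrow> 'a \<Rightarrow> 'a) \<Rightarrow> 'a set \<Rightarrow> bool" where
  "free_cd_system_on (_ :: 'b itself) S op B \<longleftrightarrow>
     cd_system S op \<and> B \<subseteq> S \<and>
     (\<forall>(T :: 'b set) op'. cd_system T op' \<longrightarrow>
        (\<forall>f \<in> B \<rightarrow> T. \<exists>!h. h \<in> cd_hom S op T op' \<inter> extensional S \<and> (\<forall>b\<in>B. h b = f b)))"


section \<open>Terms and CD-equivalence\<close>

text \<open>\<open>Var i\<close> stands for the variable $x_{i+1}$.\<close>

datatype cd_term = Var nat | App cd_term cd_term

inductive cd_eq :: "cd_term \<Rightarrow> cd_term \<Rightarrow> bool" (infix "=\<^bsub>CD\<^esub>" 50) where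
  cd_eq_base: "App t0 (App t1 t2) =\<^bsub>CD\<^esub> App (App t0 t1) (App t1 t2)"
| cd_eq_refl: "t =\<^bsub>CD\<^esub> t"
| cd_eq_sym: "s =\<^bsub>CD\<^esub> t \<Longrightarrow> t =\<^bsub>CD\<^esub> s"
| cd_eq_trans: "\<lbrakk>s =\<^bsub>CD\<^esub> t; t =\<^bsub>CD\<^esub> u\<rbrakk> \<Longrightarrow> s =\<^bsub>CD\<^esub> u"
| cd_eq_cong: "\<lbrakk>s =\<^bsub>CD\<^esub> s'; t =\<^bsub>CD\<^esub> t'\<rbrakk> \<Longrightarrow> App s t =\<^bsub>CD\<^esub> App s' t'"


section \<open>Primitive recursion\<close>

text \<open>
  \<open>prim_rec n f\<close>: on lists of length \<open>n\<close>, \<open>f\<close> is an \<open>n\<close>-ary primitive recursive function.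
  Values of \<open>f\<close> on lists of any other length are irrelevant.
\<close>

inductive prim_rec :: "nat \<Rightarrow> (nat list \<Rightarrow> nat) \<Rightarrow> bool" where
  prim_rec_zero: "prim_rec n (\<lambda>_. 0)"
| prim_rec_succ: "prim_rec 1 (\<lambda>xs. Suc (xs ! 0))"
| prim_rec_proj: "i < n \<Longrightarrow> prim_rec n (\<lambda>xs. xs ! i)"
| prim_rec_comp: "\<lbrakk>prim_rec (length fs) g; \<forall>f \<in> set fs. prim_rec n f\<rbrakk>
       \<Longrightarrow> prim_rec n (\<lambda>xs. g (map (\<lambda>f. f xs) fs))"
| prim_rec_rec: "\<lbrakk>prim_rec n f; prim_rec (Suc (Suc n)) g\<rbrakk>
        \<Longrightarrow> prim_rec (Suc n)
              (\<lambda>xs. rec_nat (f (tl xs)) (\<lambda>k r. g (k # r # tl xs)) (hd xs))"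

text \<open>A Goedel numbering of the terms, by means of Cantor's pairing function.\<close>

fun term_code :: "cd_term \<Rightarrow> nat" where
  "term_code (Var i) = 2 * i"
| "term_code (App s t) = Suc (2 * prod_encode (term_code s, term_code t))"

lemma inj_term_code: "inj term_code"
proof (rule injI)
  show "term_code s = term_code t \<Longrightarrow> s = t" for s t
  proof (induction s arbitrary: t)
    case (Var i)
    then show ?case by (cases t) (simp_all, presburger)
  next
    case (App s1 s2)
    show ?case
    proof (cases t)
      case (Var i)
      with App.prems show ?thesis by (simp, presburger)
    next
      case (App t1 t2)
      with App.prems App.IH show ?thesis by simp
    qed
  qed
qed


section \<open>Groups given by generators and relations\<close>

text \<open>The letter \<open>(x, True)\<close> stands for the generator \<open>x\<close>, and \<open>(x, False)\<close> for its inverse.\<close>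

type_synonym 'x signed_word = "('x \<times> bool) list"

inductive_set word_rel ::
  "('x signed_word \<times> 'x signed_word) set \<Rightarrow> ('x signed_word \<times> 'x signed_word) set"
  for R :: "('x signed_word \<times> 'x signed_word) set" where
  word_rel_rel: "(u, v) \<in> R \<Longrightarrow> (u, v) \<in> word_rel R"
| word_rel_cancel: "([(x, e), (x, \<not> e)], []) \<in> word_rel R"
| word_rel_refl: "(u, u) \<in> word_rel R"
| word_rel_sym: "(u, v) \<in> word_rel R \<Longrightarrow> (v, u) \<in> word_rel R"
| word_rel_trans: "\<lbrakk>(u, v) \<in> word_rel R; (v, w) \<in> word_rel R\<rbrakk> \<Longrightarrow> (u, w) \<in> word_rel R"
| word_rel_cong: "\<lbrakk>(u, u') \<in> word_rel R; (v, v') \<in> word_rel R\<rbrakk> \<Longrightarrow> (u @ v, u' @ v') \<in> word_rel R"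

definition presented_group ::
  "('x signed_word \<times> 'x signed_word) set \<Rightarrow> 'x signed_word set monoid" where
  "presented_group R =
     \<lparr>carrier = UNIV // word_rel R,
      mult = (\<lambda>X Y. \<Union>u\<in>X. \<Union>v\<in>Y. word_rel R `` {u @ v}),
      one = word_rel R `` {[]}\<rparr>"

lemma equiv_word_rel: "equiv UNIV (word_rel R)"
proof (rule equivI)
  show "refl (word_rel R)" by (rule refl_onI) (rule word_rel_refl)
  show "sym (word_rel R)" by (rule symI) (rule word_rel_sym)
  show "trans (word_rel R)" by (rule transI) (rule word_rel_trans)
qed simp

lemma presented_group_mult:
  "word_rel R `` {u} \<otimes>\<^bsub>presented_group R\<^esub> word_rel R `` {v} = word_rel R `` {u @ v}"
proof -
  have "(\<lambda>u v. word_rel R `` {u @ v}) respects2 word_rel R"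
    by (rule congruent2I') (rule equiv_class_eq[OF equiv_word_rel word_rel_cong])
  from UN_equiv_class2[OF equiv_word_rel equiv_word_rel this UNIV_I UNIV_I]
  show ?thesis by (simp only: presented_group_def monoid.simps)
qed

lemma word_rel_inverse_right:
  "(w @ rev (map (map_prod id Not) w), []) \<in> word_rel R"
proof (induction w)
  case Nil
  show ?case by (simp add: word_rel_refl)
next
  case (Cons a w)
  obtain x e where a: "a = (x, e)" by fastforce
  have "([a] @ (w @ rev (map (map_prod id Not) w)) @ [(x, \<not> e)], [a] @ [] @ [(x, \<not> e)]) \<in> word_rel R"
    by (intro word_rel_cong word_rel_refl Cons.IH)
  moreover have "([a] @ [] @ [(x, \<not> e)], []) \<in> word_rel R"
    using word_rel_cancel[of x e R] a by simp
  ultimately have "([a] @ (w @ rev (map (map_prod id Not) w)) @ [(x, \<not> e)], []) \<in> word_rel R"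
    by (rule word_rel_trans)
  then show ?case
    using a by (simp add: id_def)
qed

lemma presented_group_carrier: "word_rel R `` {u} \<in> carrier (presented_group R)"
  by (simp add: presented_group_def quotientI)

lemma presented_group_cases:
  assumes "X \<in> carrier (presented_group R)" obtains u where "X = word_rel R `` {u}"
  using assms by (auto simp: presented_group_def elim: quotientE)

lemma presented_group_one: "\<one>\<^bsub>presented_group R\<^esub> = word_rel R `` {[]}"
  by (simp add: presented_group_def)

lemma group_presented_group: "group (presented_group R)"
proof (rule groupI)
  let ?G = "presented_group R"
  show "\<one>\<^bsub>?G\<^esub> \<in> carrier ?G"
    unfolding presented_group_one by (rule presented_group_carrier)
  show "X \<otimes>\<^bsub>?G\<^esub> Y \<in> carrier ?G" if X: "X \<in> carrier ?G" and Y: "Y \<in> carrier ?G" for X Y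
    by (rule presented_group_cases[OF X], rule presented_group_cases[OF Y])
       (simp only: presented_group_mult presented_group_carrier)
  show "X \<otimes>\<^bsub>?G\<^esub> Y \<otimes>\<^bsub>?G\<^esub> Z = X \<otimes>\<^bsub>?G\<^esub> (Y \<otimes>\<^bsub>?G\<^esub> Z)"
    if X: "X \<in> carrier ?G" and Y: "Y \<in> carrier ?G" and Z: "Z \<in> carrier ?G" for X Y Z
    by (rule presented_group_cases[OF X], rule presented_group_cases[OF Y],
        rule presented_group_cases[OF Z])
       (simp only: presented_group_mult append_assoc)
  show "\<one>\<^bsub>?G\<^esub> \<otimes>\<^bsub>?G\<^esub> X = X" if X: "X \<in> carrier ?G" for X
    by (rule presented_group_cases[OF X])
       (simp only: presented_group_mult presented_group_one append_Nil)
  show "\<exists>Y\<in>carrier ?G. Y \<otimes>\<^bsub>?G\<^esub> X = \<one>\<^bsub>?G\<^esub>" if X: "X \<in> carrier ?G" for X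
  proof -
    obtain u where u: "X = word_rel R `` {u}" using X by (rule presented_group_cases)
    let ?v = "rev (map (map_prod id Not) u)"
    have "rev (map (map_prod id Not) ?v) = u"
      by (simp add: rev_map comp_def prod.map_comp map_idI)
    then have "(?v @ u, []) \<in> word_rel R"
      using word_rel_inverse_right[of ?v R] by simp
    then have "word_rel R `` {?v} \<otimes>\<^bsub>?G\<^esub> X = \<one>\<^bsub>?G\<^esub>"
      unfolding u presented_group_one presented_group_mult
      by (rule equiv_class_eq[OF equiv_word_rel])
    then show ?thesis
      using presented_group_carrier by (rule bexI)
  qed
qed


section \<open>The group of the identity (CD)\<close>

text \<open>In addresses, \<open>False\<close> stands for 0 and \<open>True\<close> for 1.\<close>

type_synonym address = "bool list"

abbreviation positive :: "'x list \<Rightarrow> 'x signed_word" where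
  "positive w \<equiv> map (\<lambda>x. (x, True)) w"

inductive_set R_CD :: "(address signed_word \<times> address signed_word) set" where
  R_CD_perp:
    "(positive [\<gamma> @ [False] @ \<alpha>, \<gamma> @ [True] @ \<beta>],
      positive [\<gamma> @ [True] @ \<beta>, \<gamma> @ [False] @ \<alpha>]) \<in> R_CD"
| R_CD_zero:
    "(positive [\<gamma> @ [False] @ \<alpha>, \<gamma>],
      positive [\<gamma>, \<gamma> @ [False, False] @ \<alpha>]) \<in> R_CD"
| R_CD_one_zero:
    "(positive [\<gamma> @ [True, False] @ \<alpha>, \<gamma>],
      positive [\<gamma>, \<gamma> @ [False, True] @ \<alpha>, \<gamma> @ [True, False] @ \<alpha>]) \<in> R_CD"
| R_CD_one_one:
    "(positive [\<gamma> @ [True, True] @ \<alpha>, \<gamma>],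
      positive [\<gamma>, \<gamma> @ [True, True] @ \<alpha>]) \<in> R_CD"
| R_CD_one:
    "(positive [\<gamma> @ [True], \<gamma>, \<gamma> @ [False]],
      positive [\<gamma>, \<gamma> @ [True], \<gamma>]) \<in> R_CD"

definition G_CD :: "address signed_word set monoid" where
  "G_CD = presented_group R_CD"

definition gen_CD :: "address \<Rightarrow> address signed_word set" where
  "gen_CD \<alpha> = word_rel R_CD `` {[(\<alpha>, True)]}"

definition G0 :: "address signed_word set set" where
  "G0 = generate G_CD {gen_CD ([False] @ \<alpha>) |\<alpha>. True}"

text \<open>The lemmas below show that \<open>sh1\<close> is the unique endomorphism with the required values.\<close>

definition sh1 :: "address signed_word set \<Rightarrow> address signed_word set" where
  "sh1 X = (\<Union>w\<in>X. word_rel R_CD `` {map (map_prod ((@) [True]) id) w})"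

definition star_CD ::
  "address signed_word set \<Rightarrow> address signed_word set \<Rightarrow> address signed_word set"
  (infixl "\<star>" 70) where
  "a \<star> b = a \<otimes>\<^bsub>G_CD\<^esub> sh1 b \<otimes>\<^bsub>G_CD\<^esub> gen_CD [] \<otimes>\<^bsub>G_CD\<^esub> sh1 (inv\<^bsub>G_CD\<^esub> b)"

lemma group_G_CD: "group G_CD"
  by (simp add: G_CD_def group_presented_group)

lemma R_CD_shift:
  "(u, v) \<in> R_CD \<Longrightarrow> (map (map_prod ((@) [True]) id) u, map (map_prod ((@) [True]) id) v) \<in> R_CD"
proof (induction rule: R_CD.induct)
  case (R_CD_perp \<gamma> \<alpha> \<beta>)
  show ?case using R_CD.R_CD_perp[where \<gamma> = "True # \<gamma>" and \<alpha> = \<alpha> and \<beta> = \<beta>] by simp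
next
  case (R_CD_zero \<gamma> \<alpha>)
  show ?case using R_CD.R_CD_zero[where \<gamma> = "True # \<gamma>" and \<alpha> = \<alpha>] by simp
next
  case (R_CD_one_zero \<gamma> \<alpha>)
  show ?case using R_CD.R_CD_one_zero[where \<gamma> = "True # \<gamma>" and \<alpha> = \<alpha>] by simp
next
  case (R_CD_one_one \<gamma> \<alpha>)
  show ?case using R_CD.R_CD_one_one[where \<gamma> = "True # \<gamma>" and \<alpha> = \<alpha>] by simp
next
  case (R_CD_one \<gamma>)
  show ?case using R_CD.R_CD_one[where \<gamma> = "True # \<gamma>"] by simp
qed

lemma word_rel_shift:
  "(u, v) \<in> word_rel R_CD \<Longrightarrow>
   (map (map_prod ((@) [True]) id) u, map (map_prod ((@) [True]) id) v) \<in> word_rel R_CD"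
proof (induction rule: word_rel.induct)
  case (word_rel_rel u v)
  show ?case by (rule word_rel.word_rel_rel[OF R_CD_shift[OF word_rel_rel]])
next
  case (word_rel_cancel x e)
  show ?case using word_rel.word_rel_cancel[of "True # x" e R_CD] by simp
next
  case (word_rel_refl u)
  show ?case by (rule word_rel.word_rel_refl)
next
  case (word_rel_sym u v)
  show ?case by (rule word_rel.word_rel_sym[OF word_rel_sym.IH])
next
  case (word_rel_trans u v w)
  show ?case by (rule word_rel.word_rel_trans[OF word_rel_trans.IH])
next
  case (word_rel_cong u u' v v')
  show ?case unfolding map_append by (rule word_rel.word_rel_cong[OF word_rel_cong.IH])
qed

lemma sh1_class:
  "sh1 (word_rel R_CD `` {w}) = word_rel R_CD `` {map (map_prod ((@) [True]) id) w}"
  unfolding sh1_def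
proof (rule UN_equiv_class[OF equiv_word_rel])
  show "(\<lambda>w. word_rel R_CD `` {map (map_prod ((@) [True]) id) w}) respects word_rel R_CD"
    by (intro congruentI equiv_class_eq[OF equiv_word_rel] word_rel_shift)
qed simp

lemma sh1_gen_CD: "sh1 (gen_CD \<alpha>) = gen_CD ([True] @ \<alpha>)"
  by (simp add: gen_CD_def sh1_class)

lemma class_in_G_CD: "word_rel R_CD `` {u} \<in> carrier G_CD"
  by (simp add: G_CD_def presented_group_def quotientI)

lemma G_CD_cases:
  assumes "X \<in> carrier G_CD" obtains u where "X = word_rel R_CD `` {u}"
  using assms by (auto simp: G_CD_def presented_group_def elim: quotientE)

lemma mult_G_CD:
  "word_rel R_CD `` {u} \<otimes>\<^bsub>G_CD\<^esub> word_rel R_CD `` {v} = word_rel R_CD `` {u @ v}"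
  unfolding G_CD_def by (rule presented_group_mult)

lemma one_G_CD: "\<one>\<^bsub>G_CD\<^esub> = word_rel R_CD `` {[]}"
  by (simp add: G_CD_def presented_group_def)

lemma sh1_hom: "sh1 \<in> hom G_CD G_CD"
proof (rule homI)
  show "sh1 X \<in> carrier G_CD" if "X \<in> carrier G_CD" for X
    using that by (rule G_CD_cases) (simp only: sh1_class class_in_G_CD)
  show "sh1 (X \<otimes>\<^bsub>G_CD\<^esub> Y) = sh1 X \<otimes>\<^bsub>G_CD\<^esub> sh1 Y"
    if X: "X \<in> carrier G_CD" and Y: "Y \<in> carrier G_CD" for X Y
    by (rule G_CD_cases[OF X], rule G_CD_cases[OF Y])
       (simp only: mult_G_CD sh1_class map_append)
qed

lemma sh1_unique:
  assumes f: "f \<in> hom G_CD G_CD" and gen: "\<And>\<alpha>. f (gen_CD \<alpha>) = gen_CD ([True] @ \<alpha>)"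
    and X: "X \<in> carrier G_CD"
  shows "f X = sh1 X"
proof -
  interpret f: group_hom G_CD G_CD f
    using f group_G_CD by (simp add: group_hom_def group_hom_axioms_def)
  interpret s: group_hom G_CD G_CD sh1
    using sh1_hom group_G_CD by (simp add: group_hom_def group_hom_axioms_def)
  have gen_in: "gen_CD x \<in> carrier G_CD" for x
    unfolding gen_CD_def by (rule class_in_G_CD)
  have inverse: "word_rel R_CD `` {[(x, False)]} = inv\<^bsub>G_CD\<^esub> gen_CD x" for x
  proof (rule f.inv_equality[symmetric])
    show "word_rel R_CD `` {[(x, False)]} \<otimes>\<^bsub>G_CD\<^esub> gen_CD x = \<one>\<^bsub>G_CD\<^esub>"
      using equiv_class_eq[OF equiv_word_rel word_rel_cancel[of x False R_CD]]
      by (simp only: one_G_CD gen_CD_def mult_G_CD) simp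
  qed (rule gen_in class_in_G_CD)+
  have letter: "f (word_rel R_CD `` {[a]}) = sh1 (word_rel R_CD `` {[a]})" for a
  proof (cases a)
    case (Pair x e)
    have g: "f (gen_CD x) = sh1 (gen_CD x)"
      by (simp only: gen sh1_gen_CD)
    show ?thesis
    proof (cases e)
      case True
      with Pair g show ?thesis by (simp only: gen_CD_def)
    next
      case False
      with Pair g show ?thesis
        by (simp only: inverse f.hom_inv[OF gen_in] s.hom_inv[OF gen_in])
    qed
  qed
  have word: "f (word_rel R_CD `` {u}) = sh1 (word_rel R_CD `` {u})" for u
  proof (induction u)
    case Nil
    show ?case using f.hom_one s.hom_one by (simp only: one_G_CD)
  next
    case (Cons a u)
    have "word_rel R_CD `` {a # u} = word_rel R_CD `` {[a]} \<otimes>\<^bsub>G_CD\<^esub> word_rel R_CD `` {u}"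
      by (simp only: mult_G_CD append_Cons append_Nil)
    then show ?case
      by (simp only: f.hom_mult[OF class_in_G_CD class_in_G_CD]
          s.hom_mult[OF class_in_G_CD class_in_G_CD] letter Cons.IH)
  qed
  show ?thesis
    using X by (rule G_CD_cases) (simp only: word)
qed

end

theory Submission
  imports Defs "HOL-Library.Countable"
begin

text \<open>
  For one variable the free CD-system is \<open>\<epsilon>\<^sub>0\<close> with the operation \<open>x + \<omega> ^ y\<close>. In general
  \<open>(u a) b = u b\<close> holds as soon as \<open>b\<close> is an iterated left multiple \<open>((a c\<^sub>1) \<dots>) c\<^sub>m\<close> of \<open>a\<close>, and
  deleting such entries \<open>a\<close> yields unique normal forms (Cantor normal forms in the one-variable
  case). This decides the word problem. Two further facts drive the rest: normal forms in one
  variable are linearly ordered by iterated left division, and CD-equivalent terms with the same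
  skeleton are equal.

  Since \<open>t'\<close> is determined by its skeleton among the expansions of \<open>t\<close>, two positive words that
  agree on one term agree on all sufficiently deep terms. This makes positive words up to equal
  effect a left cancellative monoid, with common right multiples because expansion is confluent.
  A word that contains \<open>g\<^sub>\<emptyset>\<close> but not its inverse strictly moves the left branch of a term, so
  it cannot represent an element of \<open>G0\<close>. Hence left division in the coset system is acyclic,
  which together with the linearity above makes its monogenic subsystems free.
\<close>

section \<open>Normal forms of terms\<close>

text \<open>On normal forms, \<open>a \<prec> b\<close> says that \<open>b\<close> is an iterated left multiple of \<open>a\<close>, and
  \<open>strip a c\<close> removes from \<open>a = ((v d\<^sub>1) \<dots>) d\<^sub>k\<close> the trailing entries that \<open>c\<close> absorbs.\<close>

fun ldiv :: "cd_term \<Rightarrow> cd_term \<Rightarrow> bool" (infix "\<prec>" 50)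
  and strip :: "cd_term \<Rightarrow> cd_term \<Rightarrow> cd_term" where
  "a \<prec> Var i \<longleftrightarrow> False"
| "a \<prec> App b c \<longleftrightarrow> a \<prec> b \<or> strip a c = b"
| "strip (Var i) c = Var i"
| "strip (App a d) c = (if d \<prec> c then strip a c else App a d)"

fun nf :: "cd_term \<Rightarrow> cd_term" where
  "nf (Var i) = Var i"
| "nf (App s t) = App (strip (nf s) (nf t)) (nf t)"

text \<open>Since \<open>\<prec>\<close> and \<open>strip\<close> call each other, three facts are
  proved at once by induction on a bound for the total size. Transitivity uses the second fact when
  \<open>b\<close> reaches \<open>c\<close> through the second clause of \<open>\<prec>\<close>. The
  second uses the collapse of nested strips. The collapse uses transitivity to see that what
  \<open>b\<close> absorbs is absorbed by \<open>c\<close>.\<close>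

lemma ldiv_trans_aux:
  "(size a + size b + size c < n \<longrightarrow> a \<prec> b \<longrightarrow> b \<prec> c \<longrightarrow> a \<prec> c) \<and>
   (size a + size b + size c < n \<longrightarrow> a \<prec> b \<longrightarrow> a \<prec> App (strip b c) c) \<and>
   (size a + size b + size c < n \<longrightarrow> b \<prec> c \<longrightarrow> strip (strip a b) c = strip a c)"
proof (induction n arbitrary: a b c)
  case 0
  show ?case by simp
next
  case (Suc n)
  note T = Suc.IH[THEN conjunct1, rule_format]
    and U = Suc.IH[THEN conjunct2, THEN conjunct1, rule_format]
    and D = Suc.IH[THEN conjunct2, THEN conjunct2, rule_format]
  show ?case
  proof (intro conjI impI)
    assume n: "size a + size b + size c < Suc n" and ab: "a \<prec> b" and bc: "b \<prec> c"
    obtain c' d where c: "c = App c' d" using bc by (cases c) auto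
    show "a \<prec> c"
      using n ab bc T[of a b c'] U[of a b d] by (auto simp: c)
  next
    assume n: "size a + size b + size c < Suc n" and ab: "a \<prec> b"
    obtain b' e where b: "b = App b' e" using ab by (cases b) auto
    show "a \<prec> App (strip b c) c"
      using n ab U[of a b' c] D[of a e c] by (auto simp: b)
  next
    assume n: "size a + size b + size c < Suc n" and bc: "b \<prec> c"
    show "strip (strip a b) c = strip a c"
    proof (cases a)
      case (App a' f)
      then show ?thesis using n bc D[of a' b c] T[of f b c] by auto
    qed simp
  qed
qed

lemma ldiv_trans: "\<lbrakk>a \<prec> b; b \<prec> c\<rbrakk> \<Longrightarrow> a \<prec> c"
  using ldiv_trans_aux by blast

lemma strip_strip: "b \<prec> c \<Longrightarrow> strip (strip a b) c = strip a c"
  using ldiv_trans_aux by blast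

text \<open>The extra entry satisfies \<open>nf b \<prec> nf (App b c)\<close>, so the outer
  \<open>strip\<close> deletes it, and \<open>strip_strip\<close> then removes the inner
  \<open>strip\<close>.\<close>

lemma nf_cd: "nf (App a (App b c)) = nf (App (App a b) (App b c))"
  using strip_strip[of "nf b" "nf (App b c)" "nf a"] by simp

lemma nf_cong: "s =\<^bsub>CD\<^esub> t \<Longrightarrow> nf s = nf t"
proof (induction rule: cd_eq.induct)
  case (cd_eq_base a b c)
  show ?case by (rule nf_cd)
qed simp_all

declare cd_eq_refl [simp, intro] cd_eq_trans [trans]

text \<open>Soundness of deleting entries. When \<open>b\<close> is equivalent to
  \<open>App a c\<close>, absorption of \<open>a\<close> is the axiom itself; the general case
  descends the left branch of \<open>b\<close>. The second claim iterates the first, which in turn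
  needs it to replace \<open>App (strip a c) c\<close> by \<open>App a c\<close>.\<close>

lemma ldiv_absorb_strip_aux:
  "(size a + size b < n \<longrightarrow> a \<prec> b \<longrightarrow> (\<forall>u. App (App u a) b =\<^bsub>CD\<^esub> App u b)) \<and>
   (size a + size b < n \<longrightarrow> App (strip a b) b =\<^bsub>CD\<^esub> App a b)"
proof (induction n arbitrary: a b)
  case 0
  show ?case by simp
next
  case (Suc n)
  note L = Suc.IH[THEN conjunct1, rule_format] and S = Suc.IH[THEN conjunct2, rule_format]
  show ?case
  proof (intro conjI impI allI)
    fix u
    assume n: "size a + size b < Suc n" and ab: "a \<prec> b"
    obtain b' c where b: "b = App b' c" using ab by (cases b) auto
    show "App (App u a) b =\<^bsub>CD\<^esub> App u b"
    proof (cases "a \<prec> b'")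
      case True
      \<comment> \<open>The axiom inserts \<open>b'\<close> after \<open>u\<close>, absorption of
        \<open>a\<close> by \<open>b'\<close> changes \<open>u\<close> to \<open>App u a\<close>,
        and the axiom removes \<open>b'\<close> again.\<close>
      have "App u b =\<^bsub>CD\<^esub> App (App u b') b"
        unfolding b by (rule cd_eq_base)
      also have "\<dots> =\<^bsub>CD\<^esub> App (App (App u a) b') b"
        by (intro cd_eq_cong cd_eq_refl cd_eq_sym[OF L]) (use n b True in auto)
      also have "\<dots> =\<^bsub>CD\<^esub> App (App u a) b"
        unfolding b by (rule cd_eq_sym[OF cd_eq_base])
      finally show ?thesis by (rule cd_eq_sym)
    next
      case False
      then have s: "b' = strip a c" using ab b by simp
      have bac: "b =\<^bsub>CD\<^esub> App a c" unfolding b s by (rule S) (use n b in auto)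
      have "App u b =\<^bsub>CD\<^esub> App u (App a c)" by (intro cd_eq_cong bac cd_eq_refl)
      also have "\<dots> =\<^bsub>CD\<^esub> App (App u a) (App a c)" by (rule cd_eq_base)
      also have "\<dots> =\<^bsub>CD\<^esub> App (App u a) b"
        by (intro cd_eq_cong cd_eq_sym[OF bac] cd_eq_refl)
      finally show ?thesis by (rule cd_eq_sym)
    qed
  next
    assume n: "size a + size b < Suc n"
    show "App (strip a b) b =\<^bsub>CD\<^esub> App a b"
    proof (cases a)
      case (App a' d)
      show ?thesis
      proof (cases "d \<prec> b")
        case True
        have "App (strip a' b) b =\<^bsub>CD\<^esub> App a' b"
          by (rule S) (use n App in auto)
        also have "\<dots> =\<^bsub>CD\<^esub> App a b"
          unfolding App by (rule cd_eq_sym[OF L]) (use n App True in auto)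
        finally show ?thesis using App True by simp
      qed (simp add: App)
    qed simp
  qed
qed

lemma strip_cd_eq: "App (strip a b) b =\<^bsub>CD\<^esub> App a b"
  using ldiv_absorb_strip_aux by blast

lemma nf_cd_eq: "nf t =\<^bsub>CD\<^esub> t"
proof (induction t)
  case (App s t)
  have "nf (App s t) =\<^bsub>CD\<^esub> App (nf s) (nf t)" by (simp add: strip_cd_eq)
  also have "\<dots> =\<^bsub>CD\<^esub> App s t" by (intro cd_eq_cong App)
  finally show ?case .
qed simp

theorem cd_eq_iff_nf: "s =\<^bsub>CD\<^esub> t \<longleftrightarrow> nf s = nf t"
  by (metis nf_cong nf_cd_eq cd_eq_sym cd_eq_trans)

lemma nf_App_left: "nf s \<prec> nf (App s t)"
  by simp

definition ldiv1 :: "(cd_term \<times> cd_term) set" where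
  "ldiv1 = {(s, t). \<exists>c. App s c =\<^bsub>CD\<^esub> t}"

text \<open>Unlike \<open>\<prec>\<close>, which is tied to normal forms, a chain of left divisions
  is carried along by every map respecting CD-equivalence. This is how the order is transported by
  \<open>skel\<close> and by evaluation in a CD-system.\<close>

lemma ldiv_trancl: "a \<prec> b \<Longrightarrow> (a, b) \<in> ldiv1\<^sup>+"
proof (induction b)
  case (App b c)
  have "(a, App a c) \<in> ldiv1 \<and> (b, App b c) \<in> ldiv1" by (auto simp: ldiv1_def)
  moreover have "(a, App b c) \<in> ldiv1" if "strip a c = b"
    using strip_cd_eq[of a c] that cd_eq_sym by (auto simp: ldiv1_def)
  ultimately show ?case
    using App.IH(1) App.prems by (metis ldiv.simps(2) r_into_trancl trancl_into_trancl)
qed simp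

section \<open>Reduced terms and their comparability\<close>

fun reduced :: "cd_term \<Rightarrow> bool" where
  "reduced (Var i) \<longleftrightarrow> True"
| "reduced (App a c) \<longleftrightarrow> reduced a \<and> reduced c \<and> strip a c = a"

lemma strip_idem: "strip (strip a c) c = strip a c"
  by (induction a) auto

lemma reduced_strip: "reduced a \<Longrightarrow> reduced (strip a c)"
  by (induction a) auto

lemma reduced_nf: "reduced (nf t)"
  by (induction t) (auto simp: strip_idem reduced_strip)

text \<open>In a reduced \<open>App a c\<close> one has \<open>a \<prec> App a c\<close>, so
  \<open>App a c \<prec> a\<close> would give \<open>a \<prec> a\<close>; and \<open>c\<close>
  cannot absorb itself, again by induction.\<close>

lemma ldiv_irrefl: "reduced a \<Longrightarrow> \<not> a \<prec> a"
proof (induction a)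
  case (App a c)
  have "a \<prec> App a c" using App.prems by simp
  then have "\<not> App a c \<prec> a" using ldiv_trans[of a "App a c" a] App by auto
  then show ?case using App by auto
qed simp

lemma strip_prefix: "reduced a \<Longrightarrow> strip a c = a \<or> strip a c \<prec> a"
proof (induction a)
  case (App a d)
  have "a \<prec> App a d" using App.prems by simp
  then show ?case using App ldiv_trans by auto
qed simp

text \<open>Predecessors of \<open>App c' d\<close> lie below \<open>c'\<close> or strip to
  \<open>c'\<close> under \<open>d\<close>, so the first claim descends to smaller instances of
  either claim. In the second claim, last entries that are stripped lie below \<open>c\<close>,
  hence are comparable by the first claim; this decides the only case that shortening one side
  leaves open.\<close>

lemma ldiv_comparable_aux:
  "(size a + size b + size c < n \<longrightarrow> reduced a \<longrightarrow> reduced b \<longrightarrow> reduced c \<longrightarrow> a \<prec> c \<longrightarrow> b \<prec> c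
      \<longrightarrow> a = b \<or> a \<prec> b \<or> b \<prec> a) \<and>
   (size a + size b + size c < n \<longrightarrow> reduced a \<longrightarrow> reduced b \<longrightarrow> reduced c \<longrightarrow> strip a c = strip b c
      \<longrightarrow> a = b \<or> a \<prec> b \<or> b \<prec> a)"
proof (induction n arbitrary: a b c)
  case 0
  show ?case by simp
next
  case (Suc n)
  note C = Suc.IH[THEN conjunct1, rule_format] and S = Suc.IH[THEN conjunct2, rule_format]
  show ?case
  proof (intro conjI impI)
    assume n: "size a + size b + size c < Suc n"
      and nm: "reduced a" "reduced b" "reduced c" and ac: "a \<prec> c" and bc: "b \<prec> c"
    obtain c' d where c: "c = App c' d" using ac by (cases c) auto
    have *: "x \<prec> strip y d \<Longrightarrow> reduced y \<Longrightarrow> x \<prec> y" for x y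
      using strip_prefix[of y d] ldiv_trans by metis
    show "a = b \<or> a \<prec> b \<or> b \<prec> a"
    proof -
      have "a \<prec> c' \<or> strip a d = c'" "b \<prec> c' \<or> strip b d = c'"
        using ac bc c by auto
      moreover have ?thesis if "a \<prec> c'" "b \<prec> c'"
        by (rule C[of a b c']) (use n nm that c in auto)
      moreover have ?thesis if "strip a d = c'" "strip b d = c'"
        by (rule S[of a b d]) (use n nm that c in auto)
      ultimately show ?thesis
        using *[of a b] *[of b a] nm by blast
    qed
  next
    assume n: "size a + size b + size c < Suc n"
      and nm: "reduced a" "reduced b" "reduced c" and s: "strip a c = strip b c"
    show "a = b \<or> a \<prec> b \<or> b \<prec> a"
    proof (cases "strip a c = a \<or> strip b c = b")
      case True
      then show ?thesis using strip_prefix nm s by metis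
    next
      case False
      obtain a' d where a: "a = App a' d" and d: "d \<prec> c" using False by (cases a) (auto split: if_splits)
      obtain b' e where b: "b = App b' e" and e: "e \<prec> c" using False by (cases b) (auto split: if_splits)
      have a'a: "a' \<prec> a" and b'b: "b' \<prec> b" using nm a b by auto
      have sa: "strip a' c = strip a c" and sb: "strip b' c = strip b c" using a b d e by auto
      have de: "d = e \<or> d \<prec> e \<or> e \<prec> d"
        using C[of d e c] n nm d e by (auto simp: a b)
      have 1: "a = b' \<or> a \<prec> b' \<or> b' \<prec> a"
        using S[of a b' c] n nm s sb by (auto simp: b)
      have 2: "a' = b \<or> a' \<prec> b \<or> b \<prec> a'"
        using S[of a' b c] n nm s sa by (auto simp: a)
      have eq: ?thesis if "a' = b'"
        using that de nm by (auto simp: a b)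
      \<comment> \<open>If \<open>e\<close> strips \<open>x\<close> down to a smaller
        \<open>y\<close> while \<open>d\<close> strips nothing from \<open>x\<close>, then
        \<open>d\<close> must be below \<open>e\<close>: otherwise \<open>d = e\<close>, or
        \<open>d\<close> would absorb all that \<open>e\<close> absorbs. So \<open>e\<close> absorbs
        \<open>d\<close> as well.\<close>
      have key: "App x d \<prec> App y e"
        if nx: "reduced (App x d)" and ny: "reduced (App y e)" and yx: "y \<prec> x" and xy: "strip x e = y"
          and de: "d = e \<or> d \<prec> e \<or> e \<prec> d" for x y d e
      proof -
        have irr: "\<not> x \<prec> y" "x \<noteq> y"
          using yx ldiv_irrefl[of x] ldiv_trans[of x y x] nx by auto
        have "d \<noteq> e" using nx xy irr by auto
        moreover have "\<not> e \<prec> d"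
        proof
          assume "e \<prec> d"
          then have "strip y d = x" using strip_strip[of e d x] xy nx by simp
          then show False using strip_prefix[of y d] ny irr by auto
        qed
        ultimately show ?thesis using de xy by auto
      qed
      show ?thesis
      \<comment> \<open>Otherwise \<open>1\<close> gives \<open>a = b'\<close> or
        \<open>a \<prec> b'\<close>, hence \<open>a \<prec> b\<close>; or \<open>2\<close> gives
        \<open>b \<prec> a\<close> symmetrically.\<close>
      proof (cases "b' \<prec> a \<and> a' \<prec> b")
        case False
        then show ?thesis using 1 2 a'a b'b ldiv_trans by metis
      next
        case True
        then have 3: "b' \<prec> a' \<or> strip b' d = a'" and 4: "a' \<prec> b' \<or> strip a' e = b'"
          by (simp_all add: a b)
        have irr: "\<not> (a' \<prec> b' \<and> b' \<prec> a')"
          using ldiv_irrefl ldiv_trans nm a by (metis reduced.simps(2))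
        have "a' = b'" if "strip b' d = a'" "strip a' e = b'"
          using that strip_prefix[of b' d] strip_prefix[of a' e] irr nm by (auto simp: a b)
        moreover have "a \<prec> b" if "b' \<prec> a'" "strip a' e = b'"
          unfolding a b by (rule key) (use that de nm a b in auto)
        moreover have "b \<prec> a" if "a' \<prec> b'" "strip b' d = a'"
          unfolding a b by (rule key) (use that de nm a b in auto)
        ultimately show ?thesis using 3 4 irr eq by blast
      qed
    qed
  qed
qed

lemma strip_eq_comparable:
  "\<lbrakk>reduced a; reduced b; reduced c; strip a c = strip b c\<rbrakk> \<Longrightarrow> a = b \<or> a \<prec> b \<or> b \<prec> a"
  using ldiv_comparable_aux by blast

section \<open>Skeletons and one-variable terms\<close>

fun skel :: "cd_term \<Rightarrow> cd_term" where
  "skel (Var i) = Var 0"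
| "skel (App s t) = App (skel s) (skel t)"

lemma skel_idem [simp]: "skel (skel t) = skel t"
  by (induction t) auto

lemma cd_eq_skel: "s =\<^bsub>CD\<^esub> t \<Longrightarrow> skel s =\<^bsub>CD\<^esub> skel t"
proof (induction rule: cd_eq.induct)
  case (cd_eq_trans s t u)
  then show ?case by (blast intro: cd_eq.cd_eq_trans)
qed (simp_all add: cd_eq_base cd_eq_sym cd_eq_cong)

text \<open>Right powers. With \<open>Var 0\<close> read as the ordinal 0 and products as x +
  \<omega>^y, they are the towers of \<omega>, cofinal in \<epsilon>_0.\<close>

fun rpow :: "nat \<Rightarrow> cd_term" where
  "rpow 0 = Var 0"
| "rpow (Suc n) = App (Var 0) (rpow n)"

lemma reduced_rpow: "reduced (rpow n)"
  by (induction n) auto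

text \<open>Every entry \<open>d\<close> of \<open>a\<close> is smaller than \<open>a\<close>, so by
  induction \<open>strip d (rpow n) = Var 0\<close>; that is exactly
  \<open>d \<prec> rpow (Suc n)\<close>, and all entries are absorbed.\<close>

lemma strip_rpow: "\<lbrakk>skel a = a; size a \<le> n\<rbrakk> \<Longrightarrow> strip a (rpow n) = Var 0"
proof (induction n arbitrary: a)
  case 0
  then show ?case by (cases a) auto
next
  case (Suc n)
  have "skel b = b \<Longrightarrow> size b \<le> size a \<Longrightarrow> strip b (rpow (Suc n)) = Var 0" for b
    using Suc by (induction b) auto
  then show ?case using Suc.prems by blast
qed

lemma skel_strip: "skel a = a \<Longrightarrow> skel (strip a b) = strip a b"
  by (induction a) auto

lemma skel_nf: "skel t = t \<Longrightarrow> skel (nf t) = nf t"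
  by (induction t) (auto simp: skel_strip)

text \<open>The condition \<open>skel t = t\<close> says that \<open>Var 0\<close> is the only
  variable. A large right power strips both normal forms to \<open>Var 0\<close>, which makes them
  comparable.\<close>

lemma one_variable_total:
  assumes "skel s = s" "skel t = t"
  shows "nf s = nf t \<or> nf s \<prec> nf t \<or> nf t \<prec> nf s"
proof (rule strip_eq_comparable[where c = "rpow (size (nf s) + size (nf t))"])
  show "strip (nf s) (rpow (size (nf s) + size (nf t))) = strip (nf t) (rpow (size (nf s) + size (nf t)))"
    using assms by (simp add: strip_rpow skel_nf)
qed (simp_all add: reduced_nf reduced_rpow)

text \<open>Identifying variables can create new absorptions, so \<open>strip\<close> is not
  followed directly; single left divisions are mapped to \<open>\<prec>\<close> and then composed by
  transitivity.\<close>

lemma ldiv_skel: "a \<prec> b \<Longrightarrow> nf (skel a) \<prec> nf (skel b)"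
proof -
  have *: "nf (skel a) \<prec> nf (skel b)" if ab: "(a, b) \<in> ldiv1" for a b
  proof -
    obtain c where "App a c =\<^bsub>CD\<^esub> b" using ab by (auto simp: ldiv1_def)
    then have "nf (skel (App a c)) = nf (skel b)" by (intro nf_cong cd_eq_skel)
    then show ?thesis using nf_App_left[of "skel a" "skel c"] by simp
  qed
  assume "a \<prec> b"
  then have "(a, b) \<in> ldiv1\<^sup>+" by (rule ldiv_trancl)
  then show ?thesis
  proof (induction rule: trancl_induct)
    case (base b)
    then show ?case by (rule *)
  next
    case (step b c)
    show ?case using step.IH *[OF step.hyps(2)] by (rule ldiv_trans)
  qed
qed

text \<open>Equal normal forms force the normal forms of the left factors to be comparable. A strict
  relation would survive in one variable, where both sides coincide, against irreflexivity. So the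
  factors are equivalent pairwise and the induction applies.\<close>

theorem cd_eq_same_skel:
  assumes "s =\<^bsub>CD\<^esub> t" "skel s = skel t"
  shows "s = t"
  using assms
proof (induction s arbitrary: t)
  case (Var i)
  then show ?case using nf_cong[OF Var.prems(1)] by (cases t) auto
next
  case (App s1 s2)
  obtain t1 t2 where t: "t = App t1 t2" using App.prems by (cases t) auto
  have n2: "nf s2 = nf t2" using nf_cong[OF App.prems(1)] by (simp add: t)
  moreover have "strip (nf s1) (nf s2) = strip (nf t1) (nf s2)"
    using nf_cong[OF App.prems(1)] n2 by (simp add: t)
  ultimately have "nf s1 = nf t1 \<or> nf s1 \<prec> nf t1 \<or> nf t1 \<prec> nf s1"
    by (intro strip_eq_comparable[of _ _ "nf s2"]) (auto simp: reduced_nf)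
  moreover have "nf (skel (nf s1)) = nf (skel (nf t1))"
    using App.prems by (metis t skel.simps(2) cd_term.inject(2) cd_eq_skel nf_cd_eq nf_cong)
  ultimately have "nf s1 = nf t1"
    using ldiv_skel ldiv_irrefl reduced_nf by metis
  then show ?case using App n2 t by (auto simp: cd_eq_iff_nf)
qed


section \<open>Primitive recursive functions\<close>

text \<open>Unlike \<open>prim_rec\<close>, this notion is insensitive to the values on lists of other lengths.\<close>

definition pr :: "nat \<Rightarrow> (nat list \<Rightarrow> nat) \<Rightarrow> bool" where
  "pr n f \<longleftrightarrow> (\<exists>g. prim_rec n g \<and> (\<forall>xs. length xs = n \<longrightarrow> g xs = f xs))"

lemma pr_proj: "i < n \<Longrightarrow> pr n (\<lambda>xs. xs ! i)"
  using prim_rec_proj by (auto simp: pr_def)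

lemma pr_comp:
  assumes g: "pr (length fs) g" and fs: "\<forall>f \<in> set fs. pr n f"
  shows "pr n (\<lambda>xs. g (map (\<lambda>f. f xs) fs))"
proof -
  obtain g' where g': "prim_rec (length fs) g'" "\<And>xs. length xs = length fs \<Longrightarrow> g' xs = g xs"
    using g by (auto simp: pr_def)
  obtain c where c: "\<forall>f \<in> set fs. prim_rec n (c f) \<and> (\<forall>xs. length xs = n \<longrightarrow> c f xs = f xs)"
    using bchoice[of "set fs" "\<lambda>f g. prim_rec n g \<and> (\<forall>xs. length xs = n \<longrightarrow> g xs = f xs)"] fs
    unfolding pr_def by blast
  have "prim_rec n (\<lambda>xs. g' (map (\<lambda>f. f xs) (map c fs)))"
    by (rule prim_rec_comp) (use g' c in auto)
  moreover have "g' (map (\<lambda>f. f xs) (map c fs)) = g (map (\<lambda>f. f xs) fs)" if "length xs = n" for xs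
  proof -
    have "map (\<lambda>f. f xs) (map c fs) = map (\<lambda>f. f xs) fs" using c that by simp
    then show ?thesis using g'(2)[of "map (\<lambda>f. f xs) fs"] by (simp del: map_map)
  qed
  ultimately show ?thesis by (auto simp: pr_def)
qed

lemma pr_comp1:
  assumes "pr 1 (\<lambda>xs. g (xs ! 0))" "pr n f"
  shows "pr n (\<lambda>xs. g (f xs))"
  using pr_comp[of "[f]" "\<lambda>xs. g (xs ! 0)" n] assms by simp

lemma pr_comp2:
  assumes "pr 2 (\<lambda>xs. g (xs ! 0) (xs ! 1))" "pr n f1" "pr n f2"
  shows "pr n (\<lambda>xs. g (f1 xs) (f2 xs))"
  using pr_comp[of "[f1, f2]" "\<lambda>xs. g (xs ! 0) (xs ! 1)" n] assms by (simp add: numeral_2_eq_2)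

lemma pr_zero: "pr n (\<lambda>_. 0)"
  using prim_rec_zero by (auto simp: pr_def)

lemma pr_Suc: "pr n f \<Longrightarrow> pr n (\<lambda>xs. Suc (f xs))"
  by (rule pr_comp1[where g = Suc]) (use prim_rec_succ in \<open>auto simp: pr_def\<close>)

lemma pr_const: "pr n (\<lambda>_. c)"
  by (induction c) (auto intro: pr_zero pr_Suc)

text \<open>The base value \<open>F 0\<close> is a number and enters as a nullary constant, so only
  the successor equation remains to be supplied.\<close>

lemma pr_rec1:
  assumes G: "pr 2 (\<lambda>xs. G (xs ! 0) (xs ! 1))" and F: "\<And>k. F (Suc k) = G k (F k)" and f: "pr n f"
  shows "pr n (\<lambda>xs. F (f xs))"
proof (rule pr_comp1[OF _ f])
  obtain g where g: "prim_rec 2 g" "\<And>xs. length xs = 2 \<Longrightarrow> g xs = G (xs ! 0) (xs ! 1)"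
    using G by (auto simp: pr_def)
  obtain c where c: "prim_rec 0 c" "c [] = F 0"
    using pr_const[of 0 "F 0"] by (auto simp: pr_def)
  let ?r = "\<lambda>xs. rec_nat (c (tl xs)) (\<lambda>k r. g (k # r # tl xs)) (hd xs)"
  have "prim_rec (Suc 0) ?r"
    by (rule prim_rec_rec) (use g c in \<open>auto simp: numeral_2_eq_2\<close>)
  moreover have "rec_nat (c []) (\<lambda>k r. g [k, r]) m = F m" for m
    by (induction m) (auto simp: c g F)
  then have "?r xs = F (xs ! 0)" if "length xs = 1" for xs
    using that by (auto simp: length_Suc_conv)
  ultimately show "pr 1 (\<lambda>xs. F (xs ! 0))"
    unfolding pr_def One_nat_def by blast
qed

lemma pr_rec2:
  assumes G: "pr 3 (\<lambda>xs. G (xs ! 0) (xs ! 1) (xs ! 2))" and B: "pr 1 (\<lambda>xs. F 0 (xs ! 0))"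
    and F: "\<And>k y. F (Suc k) y = G k (F k y) y" and f: "pr n f1" "pr n f2"
  shows "pr n (\<lambda>xs. F (f1 xs) (f2 xs))"
proof (rule pr_comp2[OF _ f])
  obtain g where g: "prim_rec 3 g" "\<And>xs. length xs = 3 \<Longrightarrow> g xs = G (xs ! 0) (xs ! 1) (xs ! 2)"
    using G by (auto simp: pr_def)
  obtain b where b: "prim_rec 1 b" "\<And>xs. length xs = 1 \<Longrightarrow> b xs = F 0 (xs ! 0)"
    using B by (auto simp: pr_def)
  let ?r = "\<lambda>xs. rec_nat (b (tl xs)) (\<lambda>k r. g (k # r # tl xs)) (hd xs)"
  have "prim_rec (Suc 1) ?r"
    by (rule prim_rec_rec) (use g b in \<open>auto simp: numeral_3_eq_3\<close>)
  moreover have "rec_nat (b [y]) (\<lambda>k r. g [k, r, y]) m = F m y" for m y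
    by (induction m) (auto simp: b g F)
  then have "?r xs = F (xs ! 0) (xs ! 1)" if "length xs = 2" for xs
    using that by (auto simp: length_Suc_conv numeral_2_eq_2)
  ultimately show "pr 2 (\<lambda>xs. F (xs ! 0) (xs ! 1))"
    unfolding pr_def numeral_2_eq_2 One_nat_def by blast
qed

section \<open>Arithmetic and Cantor pairing as primitive recursive functions\<close>

named_theorems pr_intros

lemmas [pr_intros] = pr_proj pr_Suc pr_const

lemma pr_add [pr_intros]: "\<lbrakk>pr n f; pr n g\<rbrakk> \<Longrightarrow> pr n (\<lambda>xs. f xs + g xs)"
  by (rule pr_rec2[where F = "(+)" and G = "\<lambda>k r y. Suc r"]) (assumption | intro pr_intros | simp)+

lemma pr_pred [pr_intros]: "pr n f \<Longrightarrow> pr n (\<lambda>xs. f xs - 1)"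
  by (rule pr_rec1[where F = "\<lambda>k. k - 1" and G = "\<lambda>k r. k"]) (assumption | intro pr_intros | simp)+

lemma pr_diff [pr_intros]: "\<lbrakk>pr n f; pr n g\<rbrakk> \<Longrightarrow> pr n (\<lambda>xs. f xs - g xs)"
  by (rule pr_rec2[where F = "\<lambda>k y. y - k" and G = "\<lambda>k r y. r - 1"]) (assumption | intro pr_intros | simp)+

lemma pr_mult [pr_intros]: "\<lbrakk>pr n f; pr n g\<rbrakk> \<Longrightarrow> pr n (\<lambda>xs. f xs * g xs)"
  by (rule pr_rec2[where F = "(*)" and G = "\<lambda>k r y. y + r"]) (assumption | intro pr_intros | simp)+

lemma pr_if [pr_intros]:
  assumes "pr n (\<lambda>xs. of_bool (P xs))" "pr n f" "pr n g"
  shows "pr n (\<lambda>xs. if P xs then f xs else g xs)"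
proof -
  have "(if P xs then f xs else g xs) = of_bool (P xs) * f xs + (1 - of_bool (P xs)) * g xs" for xs
    by simp
  then show ?thesis using assms by (simp only:) (intro pr_intros)
qed

lemma pr_eq [pr_intros]: "\<lbrakk>pr n f; pr n g\<rbrakk> \<Longrightarrow> pr n (\<lambda>xs. of_bool (f xs = g xs))"
proof -
  have "(of_bool (f xs = g xs) :: nat) = 1 - ((f xs - g xs) + (g xs - f xs))" for xs
    by simp
  then show "\<lbrakk>pr n f; pr n g\<rbrakk> \<Longrightarrow> pr n (\<lambda>xs. of_bool (f xs = g xs))"
    by (simp only:) (intro pr_intros)
qed

lemma pr_disj [pr_intros]:
  "\<lbrakk>pr n (\<lambda>xs. of_bool (P xs)); pr n (\<lambda>xs. of_bool (Q xs))\<rbrakk> \<Longrightarrow> pr n (\<lambda>xs. of_bool (P xs \<or> Q xs))"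
proof -
  have "(of_bool (P xs \<or> Q xs) :: nat) = 1 - (1 - of_bool (P xs)) * (1 - of_bool (Q xs))" for xs
    by simp
  then show "\<lbrakk>pr n (\<lambda>xs. of_bool (P xs)); pr n (\<lambda>xs. of_bool (Q xs))\<rbrakk> \<Longrightarrow> ?thesis"
    by (simp only:) (intro pr_intros)
qed

lemma pr_mod2 [pr_intros]: "pr n f \<Longrightarrow> pr n (\<lambda>xs. f xs mod 2)"
  by (rule pr_rec1[where F = "\<lambda>k. k mod 2" and G = "\<lambda>k r. 1 - r"]) ((assumption | intro pr_intros | simp)+, presburger)

lemma pr_odd [pr_intros]: "pr n f \<Longrightarrow> pr n (\<lambda>xs. of_bool (odd (f xs)))"
  using pr_mod2[of n f] by (simp add: mod_2_eq_odd)

lemma pr_div2 [pr_intros]: "pr n f \<Longrightarrow> pr n (\<lambda>xs. f xs div 2)"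
  by (rule pr_rec1[where F = "\<lambda>k. k div 2" and G = "\<lambda>k r. r + k mod 2"]) ((assumption | intro pr_intros | simp)+, presburger)

lemma pr_triangle [pr_intros]: "pr n f \<Longrightarrow> pr n (\<lambda>xs. triangle (f xs))"
  by (rule pr_rec1[where F = triangle and G = "\<lambda>k r. r + Suc k"]) (assumption | intro pr_intros | simp)+

lemma pr_prod_encode [pr_intros]:
  "\<lbrakk>pr n f; pr n g\<rbrakk> \<Longrightarrow> pr n (\<lambda>xs. prod_encode (f xs, g xs))"
  unfolding prod_encode_def prod.case by (intro pr_intros)

text \<open>\<open>triangle_root n\<close> is the largest \<open>r\<close> with \<open>triangle r \<le> n\<close>; it is the sum of the two
  components of \<open>prod_decode n\<close>.\<close>

fun triangle_root :: "nat \<Rightarrow> nat" where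
  "triangle_root 0 = 0"
| "triangle_root (Suc n) =
    (if triangle (Suc (triangle_root n)) = Suc n then Suc (triangle_root n) else triangle_root n)"

lemma pr_triangle_root [pr_intros]: "pr n f \<Longrightarrow> pr n (\<lambda>xs. triangle_root (f xs))"
  by (rule pr_rec1[where F = triangle_root and
        G = "\<lambda>k r. if triangle (Suc r) = Suc k then Suc r else r"])
     (assumption | intro pr_intros | simp)+

lemma triangle_root_bounds:
  "triangle (triangle_root n) \<le> n \<and> n < triangle (Suc (triangle_root n))"
  by (induction n) auto

lemma triangle_mono: "m \<le> n \<Longrightarrow> triangle m \<le> triangle n"
  by (induction n) (auto simp: le_Suc_eq)

lemma triangle_root_prod_encode: "triangle_root (prod_encode (a, b)) = a + b"
proof -
  let ?r = "triangle_root (prod_encode (a, b))"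
  have n: "triangle (a + b) \<le> prod_encode (a, b)" "prod_encode (a, b) < triangle (Suc (a + b))"
    by (simp_all add: prod_encode_def)
  have "\<not> Suc (a + b) \<le> ?r" "\<not> Suc ?r \<le> a + b"
    using n triangle_root_bounds[of "prod_encode (a, b)"] triangle_mono
    by (meson leD le_less_trans less_le_trans)+
  then show ?thesis by simp
qed

definition pfst :: "nat \<Rightarrow> nat" where "pfst n = fst (prod_decode n)"
definition psnd :: "nat \<Rightarrow> nat" where "psnd n = snd (prod_decode n)"

lemma pfst_psnd_encode [simp]: "pfst (prod_encode (a, b)) = a" "psnd (prod_encode (a, b)) = b"
  by (simp_all add: pfst_def psnd_def)

lemma pfst_triangle_root: "pfst n = n - triangle (triangle_root n)"
  and psnd_triangle_root: "psnd n = triangle_root n - pfst n"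
proof -
  obtain a b where n: "n = prod_encode (a, b)" by (metis prod_decode_inverse surj_pair)
  show "pfst n = n - triangle (triangle_root n)" "psnd n = triangle_root n - pfst n"
    by (simp_all add: n triangle_root_prod_encode) (simp add: prod_encode_def)
qed

lemma pr_pfst [pr_intros]: "pr n f \<Longrightarrow> pr n (\<lambda>xs. pfst (f xs))"
  unfolding pfst_triangle_root by (intro pr_intros)

lemma pr_psnd [pr_intros]: "pr n f \<Longrightarrow> pr n (\<lambda>xs. psnd (f xs))"
  unfolding psnd_triangle_root by (intro pr_intros)

subsection \<open>Course-of-values recursion\<close>

text \<open>All values below the argument, nested by pairing with the latest outermost; this makes
  course-of-values recursion an ordinary primitive recursion.\<close>

fun history :: "(nat \<Rightarrow> nat \<Rightarrow> nat) \<Rightarrow> nat \<Rightarrow> nat" where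
  "history G 0 = 0"
| "history G (Suc n) = prod_encode (G n (history G n), history G n)"

definition course :: "(nat \<Rightarrow> nat \<Rightarrow> nat) \<Rightarrow> nat \<Rightarrow> nat" where
  "course G n = G n (history G n)"

text \<open>If \<open>h\<close> is the history up to \<open>n\<close>, then \<open>recall n h i\<close> is the value at \<open>i < n\<close>.\<close>

definition recall :: "nat \<Rightarrow> nat \<Rightarrow> nat \<Rightarrow> nat" where
  "recall n h i = pfst ((psnd ^^ (n - 1 - i)) h)"

lemma recall_history: "i < n \<Longrightarrow> recall n (history G n) i = course G i"
proof -
  assume "i < n"
  have "(psnd ^^ k) (history G (k + m)) = history G m" for k m
    by (induction k arbitrary: m) (simp_all add: funpow_Suc_right del: funpow.simps(2))
  from this[of "n - 1 - i" "Suc i"] \<open>i < n\<close> show ?thesis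
    by (simp add: recall_def course_def)
qed

lemma pr_recall [pr_intros]:
  assumes "pr n f" "pr n g" "pr n h"
  shows "pr n (\<lambda>xs. recall (f xs) (g xs) (h xs))"
proof -
  have "pr n (\<lambda>xs. (psnd ^^ (f xs - 1 - h xs)) (g xs))"
    by (rule pr_rec2[where F = "\<lambda>k y. (psnd ^^ k) y" and G = "\<lambda>k r y. psnd r"])
       ((rule assms | intro pr_intros | simp)+)
  then show ?thesis unfolding recall_def by (rule pr_pfst)
qed

lemma pr_course:
  assumes "pr 2 (\<lambda>xs. G (xs ! 0) (xs ! 1))" "pr n f"
  shows "pr n (\<lambda>xs. course G (f xs))"
proof -
  have "pr n (\<lambda>xs. history G (f xs))"
    by (rule pr_rec1[where F = "history G" and G = "\<lambda>k r. prod_encode (G k r, r)"])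
       ((rule assms | intro pr_intros | simp)+)
  from pr_comp2[where g = G, OF assms this] show ?thesis
    unfolding course_def .
qed

subsection \<open>Normal forms on codes\<close>

definition left_code :: "nat \<Rightarrow> nat" where "left_code n = pfst (n div 2)"
definition right_code :: "nat \<Rightarrow> nat" where "right_code n = psnd (n div 2)"

lemma code_App [simp]:
  "left_code (term_code (App s t)) = term_code s"
  "right_code (term_code (App s t)) = term_code t"
  by (simp_all add: left_code_def right_code_def)

lemma pr_left_code [pr_intros]: "pr n f \<Longrightarrow> pr n (\<lambda>xs. left_code (f xs))"
  unfolding left_code_def by (intro pr_intros)

lemma pr_right_code [pr_intros]: "pr n f \<Longrightarrow> pr n (\<lambda>xs. right_code (f xs))"
  unfolding right_code_def by (intro pr_intros)

text \<open>The argument pairs the codes of \<open>a\<close> and \<open>b\<close>; the value pairs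
  the truth value of \<open>a \<prec> b\<close> with the code of \<open>strip a b\<close>, so that
  the mutual recursion becomes a single one. Odd codes are those of applications.\<close>

definition strip_step :: "nat \<Rightarrow> nat \<Rightarrow> nat" where
  "strip_step n h =
    prod_encode
      (if odd (psnd n) then
         of_bool (pfst (recall n h (prod_encode (pfst n, left_code (psnd n)))) = 1 \<or>
           psnd (recall n h (prod_encode (pfst n, right_code (psnd n)))) = left_code (psnd n))
       else 0,
       if odd (pfst n) then
         if pfst (recall n h (prod_encode (right_code (pfst n), psnd n))) = 1
         then psnd (recall n h (prod_encode (left_code (pfst n), psnd n)))
         else pfst n
       else pfst n)"

definition nf_step :: "nat \<Rightarrow> nat \<Rightarrow> nat" where
  "nf_step n h =
    (if odd n then
       Suc (2 * prod_encode
         (psnd (course strip_step (prod_encode (recall n h (left_code n), recall n h (right_code n)))),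
          recall n h (right_code n)))
     else n)"

lemma pr_strip [pr_intros]: "pr n f \<Longrightarrow> pr n (\<lambda>xs. course strip_step (f xs))"
  by (rule pr_course, unfold strip_step_def) (assumption | intro pr_intros | simp)+

lemma pr_nf [pr_intros]: "pr n f \<Longrightarrow> pr n (\<lambda>xs. course nf_step (f xs))"
  by (rule pr_course, unfold nf_step_def) (assumption | intro pr_intros | simp)+

lemma prod_encode_less:
  "b < c \<Longrightarrow> prod_encode (a, b) < prod_encode (a, c)"
  "b < c \<Longrightarrow> prod_encode (b, a) < prod_encode (c, a)"
  using triangle_mono[of "Suc (a + b)" "a + c"] triangle_mono[of "b + a" "c + a"]
  by (auto simp: prod_encode_def)

lemma term_code_less:
  "term_code s < term_code (App s t)" "term_code t < term_code (App s t)"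
  using le_prod_encode_1[of "term_code s" "term_code t"] le_prod_encode_2[of "term_code t" "term_code s"]
  by simp_all

text \<open>Each recursive call replaces one component by the code of a proper subterm. Pairing is
  strictly increasing in both components, so the call concerns a smaller number and is found in the
  history.\<close>

lemma course_strip:
  "course strip_step (prod_encode (term_code a, term_code b)) =
    prod_encode (of_bool (a \<prec> b), term_code (strip a b))"
proof (induction "size a + size b" arbitrary: a b rule: less_induct)
  case less
  let ?n = "prod_encode (term_code a, term_code b)"
  have rec: "recall ?n (history strip_step ?n) (prod_encode (term_code a', term_code b')) =
      prod_encode (of_bool (a' \<prec> b'), term_code (strip a' b'))"
    if "prod_encode (term_code a', term_code b') < ?n" "size a' + size b' < size a + size b" for a' b'
    using recall_history[OF that(1)] less[OF that(2)] by simp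
  have 1: "(if odd (term_code b) then
         of_bool (pfst (recall ?n (history strip_step ?n) (prod_encode (term_code a, left_code (term_code b)))) = 1 \<or>
           psnd (recall ?n (history strip_step ?n) (prod_encode (term_code a, right_code (term_code b)))) = left_code (term_code b))
       else 0) = (of_bool (a \<prec> b) :: nat)"
  proof (cases b)
    case (App b' c)
    then show ?thesis
      using rec[of a b'] rec[of a c] term_code_less[of b' c] term_code_less[of c b'] prod_encode_less(1)
      by (simp del: term_code.simps add: term_code_less inj_eq[OF inj_term_code]) (simp add: inj_eq[OF inj_term_code])
  qed simp
  have 2: "(if odd (term_code a) then
         if pfst (recall ?n (history strip_step ?n) (prod_encode (right_code (term_code a), term_code b))) = 1
         then psnd (recall ?n (history strip_step ?n) (prod_encode (left_code (term_code a), term_code b)))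
         else term_code a
       else term_code a) = term_code (strip a b)"
  proof (cases a)
    case (App a' d)
    then show ?thesis
      using rec[of a' b] rec[of d b] prod_encode_less(2)
      by (simp del: term_code.simps add: term_code_less) simp
  qed simp
  show ?case
    unfolding course_def strip_step_def pfst_psnd_encode 1 2 ..
qed

lemma course_nf: "course nf_step (term_code t) = term_code (nf t)"
proof (induction t)
  case (App s t)
  let ?n = "term_code (App s t)"
  have "recall ?n (history nf_step ?n) (left_code ?n) = term_code (nf s)"
    "recall ?n (history nf_step ?n) (right_code ?n) = term_code (nf t)"
    using recall_history[OF term_code_less(1)[of s t], where G = nf_step] recall_history[OF term_code_less(2)[of t s], where G = nf_step] App
    unfolding code_App by simp_all
  then have "course nf_step ?n = Suc (2 * prod_encode (term_code (strip (nf s) (nf t)), term_code (nf t)))"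
    unfolding course_def[of nf_step ?n] nf_step_def[of ?n] by (simp only: course_strip) simp
  then show ?case by simp
qed (simp add: course_def nf_step_def)

theorem cd_eq_prim_rec:
  "\<exists>f. prim_rec 2 f \<and> (\<forall>t t'. f [term_code t, term_code t'] = (if t =\<^bsub>CD\<^esub> t' then 1 else 0))"
proof -
  have "pr 2 (\<lambda>xs. of_bool (course nf_step (xs ! 0) = course nf_step (xs ! 1)))"
    by (intro pr_intros) auto
  then obtain f where f: "prim_rec 2 f"
    "\<And>xs. length xs = 2 \<Longrightarrow> f xs = of_bool (course nf_step (xs ! 0) = course nf_step (xs ! 1))"
    by (auto simp: pr_def)
  have "f [term_code t, term_code t'] = (if t =\<^bsub>CD\<^esub> t' then 1 else 0)" for t t'
    by (simp add: f course_nf cd_eq_iff_nf inj_eq[OF inj_term_code])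
  with f(1) show ?thesis by blast
qed


section \<open>Expansions\<close>

text \<open>The partial action of the generator with address \<alpha>: the axiom is applied from
  left to right at that place.\<close>

fun expand :: "address \<Rightarrow> cd_term \<Rightarrow> cd_term option" where
  "expand [] (App s (App t u)) = Some (App (App s t) (App t u))"
| "expand (False # \<alpha>) (App s t) = map_option (\<lambda>s'. App s' t) (expand \<alpha> s)"
| "expand (True # \<alpha>) (App s t) = map_option (App s) (expand \<alpha> t)"
| "expand _ _ = None"

fun expands :: "address list \<Rightarrow> cd_term \<Rightarrow> cd_term option" where
  "expands [] t = Some t"
| "expands (\<alpha> # u) t = Option.bind (expand \<alpha> t) (expands u)"

lemma expands_append: "expands (u @ v) t = Option.bind (expands u t) (expands v)"
  by (induction u arbitrary: t) (auto split: bind_split)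

definition leads_to :: "cd_term \<Rightarrow> cd_term \<Rightarrow> bool" (infix "\<leadsto>" 50) where
  "s \<leadsto> t \<longleftrightarrow> (\<exists>u. expands u s = Some t)"

lemma leads_to_refl [simp, intro]: "t \<leadsto> t"
  unfolding leads_to_def by (rule exI[of _ "[]"]) simp

lemma leads_to_trans [trans]: "\<lbrakk>s \<leadsto> t; t \<leadsto> u\<rbrakk> \<Longrightarrow> s \<leadsto> u"
  unfolding leads_to_def by (metis expands_append bind.bind_lunit)

lemma expand_leads_to: "expand \<alpha> s = Some t \<Longrightarrow> s \<leadsto> t"
  unfolding leads_to_def by (rule exI[of _ "[\<alpha>]"]) simp

lemma leads_to_root: "App s (App t u) \<leadsto> App (App s t) (App t u)"
  by (rule expand_leads_to[of "[]"]) simp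

lemma expands_shift_left:
  "expands (map ((#) False) u) (App s t) = map_option (\<lambda>s'. App s' t) (expands u s)"
  by (induction u arbitrary: s) (auto split: bind_split simp: map_option_bind comp_def)

lemma expands_shift_right:
  "expands (map ((#) True) u) (App s t) = map_option (App s) (expands u t)"
  by (induction u arbitrary: t) (auto split: bind_split simp: map_option_bind comp_def)

lemma leads_to_App: "\<lbrakk>s \<leadsto> s'; t \<leadsto> t'\<rbrakk> \<Longrightarrow> App s t \<leadsto> App s' t'"
proof -
  assume "s \<leadsto> s'" "t \<leadsto> t'"
  then obtain u v where "expands u s = Some s'" "expands v t = Some t'"
    by (auto simp: leads_to_def)
  then have "expands (map ((#) False) u @ map ((#) True) v) (App s t) = Some (App s' t')"
    by (simp add: expands_append expands_shift_left expands_shift_right)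
  then show ?thesis by (auto simp: leads_to_def)
qed

lemma expand_cd_eq: "expand \<alpha> s = Some t \<Longrightarrow> s =\<^bsub>CD\<^esub> t"
  by (induction \<alpha> s arbitrary: t rule: expand.induct) (auto intro: cd_eq_base cd_eq_cong)

lemma expands_cd_eq: "expands u s = Some t \<Longrightarrow> s =\<^bsub>CD\<^esub> t"
proof (induction u arbitrary: s)
  case (Cons \<alpha> u)
  then obtain s' where "expand \<alpha> s = Some s'" "expands u s' = Some t"
    by (auto split: bind_splits)
  then show ?case using Cons.IH expand_cd_eq cd_eq_trans by blast
qed simp

section \<open>Complete developments and confluence\<close>

fun distr :: "cd_term \<Rightarrow> cd_term \<Rightarrow> cd_term" where
  "distr s (Var i) = App s (Var i)"
| "distr s (App a b) = App (distr s a) (App a b)"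

text \<open>A complete development: it lies beyond every single expansion of the term, as
  \<open>expand_develop\<close> shows.\<close>

fun develop :: "cd_term \<Rightarrow> cd_term" where
  "develop (Var i) = Var i"
| "develop (App s t) = distr (develop s) (develop t)"

lemma App_leads_to_distr: "App s t \<leadsto> distr s t"
proof (induction t)
  case (App a b)
  have "App s (App a b) \<leadsto> App (App s a) (App a b)" by (rule leads_to_root)
  also have "\<dots> \<leadsto> distr s (App a b)" by (auto intro: leads_to_App App)
  finally show ?case .
qed simp

lemma leads_to_develop: "t \<leadsto> develop t"
proof (induction t)
  case (App s t)
  then have "App s t \<leadsto> App (develop s) (develop t)" by (rule leads_to_App)
  also have "\<dots> \<leadsto> develop (App s t)" by (simp add: App_leads_to_distr)
  finally show ?case .
qed simp

lemma distr_mono_left: "s \<leadsto> s' \<Longrightarrow> distr s t \<leadsto> distr s' t"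
  by (induction t) (auto intro: leads_to_App)

lemma distr_expand_right: "expand \<alpha> t = Some t' \<Longrightarrow> distr s t \<leadsto> distr s t'"
proof (induction \<alpha> t arbitrary: t' rule: expand.induct)
  case (1 a b c)
  have "distr s (App a (App b c)) = App (distr s a) (App a (App b c))" by simp
  also have "\<dots> \<leadsto> App (distr s a) (App (App a b) (App b c))"
    by (intro leads_to_App leads_to_root leads_to_refl)
  also have "\<dots> \<leadsto> App (App (distr s a) (App a b)) (App (App a b) (App b c))"
    by (rule leads_to_root)
  also have "\<dots> = distr s (App (App a b) (App b c))" by simp
  finally show ?case using 1 by (simp del: distr.simps)
next
  case (2 \<alpha> a b)
  then show ?case by (auto intro!: leads_to_App intro: expand_leads_to)
next
  case (3 \<alpha> a b)
  then show ?case by (auto intro!: leads_to_App intro: expand_leads_to)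
qed auto

lemma leads_to_induct [consumes 1, case_names refl step]:
  assumes "s \<leadsto> t" "P t" "\<And>\<alpha> r r'. \<lbrakk>expand \<alpha> r = Some r'; r' \<leadsto> t; P r'\<rbrakk> \<Longrightarrow> P r"
  shows "P s"
proof -
  obtain u where "expands u s = Some t" using assms(1) by (auto simp: leads_to_def)
  then show ?thesis
  proof (induction u arbitrary: s)
    case (Cons \<alpha> u)
    then obtain s' where "expand \<alpha> s = Some s'" "expands u s' = Some t"
      by (auto split: bind_splits)
    then show ?case using assms(3) Cons.IH by (auto simp: leads_to_def)
  qed (use assms in auto)
qed

lemma distr_mono_right: "t \<leadsto> t' \<Longrightarrow> distr s t \<leadsto> distr s t'"
  by (induction rule: leads_to_induct) (auto intro: distr_expand_right leads_to_trans)

text \<open>With \<open>distr_distr_leads_to\<close>, this covers the root expansion in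
  \<open>expand_develop\<close>: for developed \<open>s\<close>, \<open>a\<close>, \<open>b\<close>,
  the developments before and after that expansion are \<open>distr s (distr a b)\<close> and
  \<open>distr (distr s a) (distr a b)\<close>.\<close>

lemma App_leads_to_distr_distr: "App (App s a) (distr a b) \<leadsto> distr s (distr a b)"
proof (induction b)
  case (Var i)
  show ?case by (auto intro: leads_to_App App_leads_to_distr)
next
  case (App b1 b2)
  have "App (App s a) (distr a (App b1 b2)) \<leadsto> App (App (App s a) (distr a b1)) (distr a (App b1 b2))"
    by (simp add: leads_to_root)
  also have "\<dots> \<leadsto> distr s (distr a (App b1 b2))"
    by (auto intro: leads_to_App App)
  finally show ?case .
qed

lemma distr_distr_leads_to: "distr s (distr a b) \<leadsto> distr (distr s a) (distr a b)"
proof (induction b)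
  case (Var i)
  have "distr s (distr a (Var i)) \<leadsto> App (App (distr s a) a) (App a (Var i))"
    by (simp add: leads_to_root)
  also have "\<dots> \<leadsto> distr (distr s a) (distr a (Var i))"
    by (auto intro: leads_to_App App_leads_to_distr)
  finally show ?case .
next
  case (App b1 b2)
  then show ?case by (auto intro: leads_to_App)
qed

text \<open>The Z-property of \<open>develop\<close>, which yields confluence although single
  expansions may duplicate subterms.\<close>

lemma expand_develop:
  "expand \<alpha> t = Some t' \<Longrightarrow> t' \<leadsto> develop t \<and> develop t \<leadsto> develop t'"
proof (induction \<alpha> t arbitrary: t' rule: expand.induct)
  case (1 s a b)
  have "t' \<leadsto> App (App (develop s) (develop a)) (distr (develop a) (develop b))"
    using 1 leads_to_develop[of "App a b"] by (auto intro!: leads_to_App leads_to_develop)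
  also have "\<dots> \<leadsto> develop (App s (App a b))"
    by (simp add: App_leads_to_distr_distr)
  finally show ?case using 1 by (auto simp: distr_distr_leads_to)
next
  case (2 \<alpha> s t)
  then obtain s' where s': "expand \<alpha> s = Some s'" "t' = App s' t" by auto
  then have "t' \<leadsto> App (develop s) (develop t)"
    using 2 by (auto intro!: leads_to_App leads_to_develop)
  also have "\<dots> \<leadsto> develop (App s t)" by (simp add: App_leads_to_distr)
  finally show ?case using 2 s' by (auto intro: distr_mono_left)
next
  case (3 \<alpha> s t)
  then obtain s' where s': "expand \<alpha> t = Some s'" "t' = App s s'" by auto
  then have "t' \<leadsto> App (develop s) (develop t)"
    using 3 by (auto intro!: leads_to_App leads_to_develop)
  also have "\<dots> \<leadsto> develop (App s t)" by (simp add: App_leads_to_distr)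
  finally show ?case using 3 s' by (auto intro: distr_mono_right)
qed auto

lemma develop_mono: "t \<leadsto> t' \<Longrightarrow> develop t \<leadsto> develop t'"
  by (induction rule: leads_to_induct) (use expand_develop leads_to_trans in blast)+

lemma expands_develop_power: "expands u s = Some t \<Longrightarrow> t \<leadsto> (develop ^^ length u) s"
proof (induction u arbitrary: s)
  case (Cons \<alpha> u)
  then obtain s' where s': "expand \<alpha> s = Some s'" "expands u s' = Some t"
    by (auto split: bind_splits)
  have "t \<leadsto> (develop ^^ length u) s'" using Cons.IH s' by blast
  \<comment> \<open>Since \<open>s'\<close> leads to \<open>develop s\<close>, monotonicity can be
    iterated.\<close>
  also have "(develop ^^ n) s' \<leadsto> (develop ^^ n) (develop s)" for n
    by (induction n) (use expand_develop[OF s'(1)] develop_mono in auto)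
  finally show ?case by (simp add: funpow_swap1)
qed simp

lemma leads_to_develop_power: "t \<leadsto> (develop ^^ n) t"
  by (induction n) (auto intro: leads_to_trans leads_to_develop)

lemma confluent:
  assumes "s \<leadsto> a" "s \<leadsto> b"
  shows "\<exists>t. a \<leadsto> t \<and> b \<leadsto> t"
proof -
  obtain u v where u: "expands u s = Some a" and v: "expands v s = Some b"
    using assms by (auto simp: leads_to_def)
  have "(develop ^^ n) s \<leadsto> (develop ^^ (m + n)) s" for m n
    using leads_to_develop_power[of "(develop ^^ n) s" m] by (simp add: funpow_add)
  then have "a \<leadsto> (develop ^^ (length v + length u)) s" "b \<leadsto> (develop ^^ (length v + length u)) s"
    using expands_develop_power[OF u] expands_develop_power[OF v] leads_to_trans
    by (blast, metis add.commute)
  then show ?thesis by blast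
qed


section \<open>Positive words\<close>

fun subst :: "(nat \<Rightarrow> cd_term) \<Rightarrow> cd_term \<Rightarrow> cd_term" where
  "subst \<sigma> (Var i) = \<sigma> i"
| "subst \<sigma> (App s t) = App (subst \<sigma> s) (subst \<sigma> t)"

fun label :: "(address \<Rightarrow> nat) \<Rightarrow> cd_term \<Rightarrow> cd_term" where
  "label e (Var i) = Var (e [])"
| "label e (App s t) = App (label (\<lambda>\<alpha>. e (False # \<alpha>)) s) (label (\<lambda>\<alpha>. e (True # \<alpha>)) t)"

fun subterm :: "cd_term \<Rightarrow> address \<Rightarrow> cd_term" where
  "subterm t [] = t"
| "subterm (App s t) (False # \<alpha>) = subterm s \<alpha>"
| "subterm (App s t) (True # \<alpha>) = subterm t \<alpha>"
| "subterm (Var i) _ = Var i"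

text \<open>Inclusion of tree shapes: it makes \<open>s\<close> a substitution instance of
  \<open>t\<close> once the leaves of \<open>t\<close> carry distinct labels.\<close>

fun covers :: "cd_term \<Rightarrow> cd_term \<Rightarrow> bool" where
  "covers s (Var i) \<longleftrightarrow> True"
| "covers (Var i) (App t u) \<longleftrightarrow> False"
| "covers (App s s') (App t t') \<longleftrightarrow> covers s t \<and> covers s' t'"

fun full :: "nat \<Rightarrow> cd_term" where
  "full 0 = Var 0"
| "full (Suc k) = App (full k) (full k)"

abbreviation deep :: "nat \<Rightarrow> cd_term \<Rightarrow> bool" where
  "deep k t \<equiv> covers t (full k)"

lemma deep_Suc: "deep (Suc k) t \<longleftrightarrow> (\<exists>a b. t = App a b \<and> deep k a \<and> deep k b)"
  by (cases t) auto

declare full.simps(2) [simp del]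

lemma deep_le: "\<lbrakk>deep k t; j \<le> k\<rbrakk> \<Longrightarrow> deep j t"
proof (induction j arbitrary: k t)
  case (Suc j)
  then obtain k' where "k = Suc k'" by (cases k) auto
  then show ?case using Suc by (auto simp: deep_Suc)
qed simp

lemma deep_size_covers: "deep (size t) s \<Longrightarrow> covers s t"
proof (induction t arbitrary: s)
  case (App t u)
  then obtain a b where s: "s = App a b" "deep (size t + size u) a" "deep (size t + size u) b"
    by (auto simp: deep_Suc)
  then show ?case using App.IH deep_le by auto
qed simp

lemma full_deep: "deep k (full k)"
  by (induction k) (auto simp: full.simps)

text \<open>The condition on \<sigma> can be met whenever \<open>e\<close> is injective. Being
  stated through \<open>e\<close>, it passes to subterms, where \<open>e\<close> is composed with a
  first address letter.\<close>

lemma subst_label: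
  "\<lbrakk>covers s t; \<And>\<alpha>. \<sigma> (e \<alpha>) = subterm s \<alpha>\<rbrakk> \<Longrightarrow> subst \<sigma> (label e t) = s"
proof (induction s t arbitrary: e rule: covers.induct)
  case (3 s s' t t')
  have "subst \<sigma> (label (\<lambda>\<alpha>. e (False # \<alpha>)) t) = s" "subst \<sigma> (label (\<lambda>\<alpha>. e (True # \<alpha>)) t') = s'"
    by (rule 3; use 3 in simp)+
  then show ?case by simp
qed auto

lemma skel_label: "skel (label e t) = skel t"
  by (induction t arbitrary: e) auto

lemma expand_subst: "expand \<alpha> t = Some t' \<Longrightarrow> expand \<alpha> (subst \<sigma> t) = Some (subst \<sigma> t')"
  by (induction \<alpha> t arbitrary: t' rule: expand.induct) auto

lemma expands_subst: "expands u t = Some t' \<Longrightarrow> expands u (subst \<sigma> t) = Some (subst \<sigma> t')"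
proof (induction u arbitrary: t)
  case (Cons \<alpha> u)
  then obtain s where "expand \<alpha> t = Some s" "expands u s = Some t'"
    by (auto split: bind_splits)
  then show ?case using Cons.IH by (simp add: expand_subst)
qed simp

lemma expand_skel: "expand \<alpha> (skel t) = map_option skel (expand \<alpha> t)"
  by (induction \<alpha> t rule: expand.induct) (auto simp: option.map_comp comp_def)

lemma expands_skel: "expands u (skel t) = map_option skel (expands u t)"
  by (induction u arbitrary: t) (auto simp: expand_skel split: bind_split)

text \<open>Two levels below the address are required for the pattern of the axiom. Expansion copies
  subterms and never lowers the depth of the complete tree contained in the term.\<close>

lemma expand_deep:
  "\<lbrakk>deep k t; length \<alpha> + 2 \<le> k\<rbrakk> \<Longrightarrow> \<exists>t'. expand \<alpha> t = Some t' \<and> deep k t'"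
proof (induction \<alpha> arbitrary: k t)
  case Nil
  then obtain j where k: "k = Suc (Suc j)" by (metis add_leD2 le_iff_add add_2_eq_Suc)
  then obtain s a b where t: "t = App s (App a b)" "deep (Suc j) s" "deep j a" "deep j b"
    using Nil by (auto simp: deep_Suc)
  then have "deep j s" using deep_le by auto
  then show ?case using t k by (simp add: deep_Suc)
next
  case (Cons x \<alpha>)
  then obtain j where k: "k = Suc j" by (cases k) auto
  then show ?case using Cons by (cases x) (fastforce simp: deep_Suc)+
qed

section \<open>Positive words up to equal effect\<close>

definition word_depth :: "address list \<Rightarrow> nat" where
  "word_depth u = sum_list (map (\<lambda>\<alpha>. length \<alpha> + 2) u)"

lemma expands_deep:
  "\<lbrakk>deep k t; word_depth u \<le> k\<rbrakk> \<Longrightarrow> \<exists>t'. expands u t = Some t' \<and> deep k t'"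
proof (induction u arbitrary: t)
  case (Cons \<alpha> u)
  then obtain t' where "expand \<alpha> t = Some t'" "deep k t'"
    using expand_deep[of t k \<alpha>] by (auto simp: word_depth_def)
  then show ?case using Cons by (auto simp: word_depth_def)
qed simp

text \<open>The existential form lets a relation be verified on a single tree and makes left
  cancellation immediate; \<open>same_effect_deep\<close> provides the universal form.\<close>

definition same_effect :: "address list \<Rightarrow> address list \<Rightarrow> bool" (infix "\<approx>" 50) where
  "u \<approx> v \<longleftrightarrow> (\<exists>t t'. expands u t = Some t' \<and> expands v t = Some t')"

lemma same_effectI: "\<lbrakk>expands u t = Some t'; expands v t = Some t'\<rbrakk> \<Longrightarrow> u \<approx> v"
  by (auto simp: same_effect_def)

text \<open>A single common value forces agreement on all terms that extend the argument: label the
  leaves injectively, and the two results are CD-equivalent with the same skeleton.\<close>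

lemma same_effect_deep:
  assumes "u \<approx> v"
  obtains k where "\<And>s j. \<lbrakk>deep j s; k \<le> j\<rbrakk> \<Longrightarrow> \<exists>s'. expands u s = Some s' \<and> expands v s = Some s' \<and> deep j s'"
proof -
  obtain t t' where t: "expands u t = Some t'" "expands v t = Some t'"
    using assms by (auto simp: same_effect_def)
  define l where "l = label to_nat t"
  have "map_option skel (expands w l) = map_option skel (expands w t)" for w
    unfolding expands_skel[symmetric] by (simp add: l_def skel_label)
  from this[of u] this[of v] obtain a b
    where ab: "expands u l = Some a" "expands v l = Some b" "skel a = skel b"
    using t by auto
  have "a =\<^bsub>CD\<^esub> b"
    using ab expands_cd_eq cd_eq_sym cd_eq_trans by blast
  then have "a = b" using ab cd_eq_same_skel by blast
  show thesis
  proof (rule that)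
    fix s j
    assume s: "deep j s" "size t + word_depth u \<le> j"
    let ?\<sigma> = "\<lambda>n. subterm s (from_nat n)"
    have "covers s t" using s deep_le[of s j "size t"] deep_size_covers by auto
    then have "subst ?\<sigma> l = s" unfolding l_def by (rule subst_label) simp
    then have "expands u s = Some (subst ?\<sigma> a)" "expands v s = Some (subst ?\<sigma> a)"
      using expands_subst[of u l a ?\<sigma>] expands_subst[of v l b ?\<sigma>] ab \<open>a = b\<close> by auto
    then show "\<exists>s'. expands u s = Some s' \<and> expands v s = Some s' \<and> deep j s'"
      using expands_deep[of s j u] s by auto
  qed
qed

lemma same_effect_refl [simp, intro]: "u \<approx> u"
  unfolding same_effect_def using expands_deep[OF full_deep] by blast

lemma same_effect_sym: "u \<approx> v \<Longrightarrow> v \<approx> u"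
  by (auto simp: same_effect_def)

text \<open>The two witness terms may differ, so both hypotheses are first moved to a common
  complete tree.\<close>

lemma same_effect_trans [trans]:
  assumes "u \<approx> v" "v \<approx> w"
  shows "u \<approx> w"
proof -
  obtain k where k: "\<And>s j. \<lbrakk>deep j s; k \<le> j\<rbrakk> \<Longrightarrow> \<exists>s'. expands u s = Some s' \<and> expands v s = Some s' \<and> deep j s'"
    using same_effect_deep[OF assms(1)] by blast
  obtain l where l: "\<And>s j. \<lbrakk>deep j s; l \<le> j\<rbrakk> \<Longrightarrow> \<exists>s'. expands v s = Some s' \<and> expands w s = Some s' \<and> deep j s'"
    using same_effect_deep[OF assms(2)] by blast
  show ?thesis
    unfolding same_effect_def
    using k[of "full (k + l)" "k + l"] l[of "full (k + l)" "k + l"] full_deep by force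
qed

lemma same_effect_append_left:
  assumes "u \<approx> v"
  shows "w @ u \<approx> w @ v"
proof -
  obtain k where k: "\<And>s j. \<lbrakk>deep j s; k \<le> j\<rbrakk> \<Longrightarrow> \<exists>s'. expands u s = Some s' \<and> expands v s = Some s' \<and> deep j s'"
    using same_effect_deep[OF assms] by blast
  let ?j = "k + word_depth w"
  obtain t where t: "expands w (full ?j) = Some t" "deep ?j t"
    using expands_deep[OF full_deep, of w ?j] by auto
  then obtain t' where "expands u t = Some t'" "expands v t = Some t'"
    using k[of t ?j] by auto
  with t show ?thesis
    by (intro same_effectI[of _ "full ?j" t']) (simp_all add: expands_append)
qed

lemma same_effect_Cons: "u \<approx> v \<Longrightarrow> \<alpha> # u \<approx> \<alpha> # v"
  using same_effect_append_left[of u v "[\<alpha>]"] by simp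

lemma same_effect_append_right:
  assumes "u \<approx> v"
  shows "u @ w \<approx> v @ w"
proof -
  obtain k where k: "\<And>s j. \<lbrakk>deep j s; k \<le> j\<rbrakk> \<Longrightarrow> \<exists>s'. expands u s = Some s' \<and> expands v s = Some s' \<and> deep j s'"
    using same_effect_deep[OF assms] by blast
  let ?j = "k + word_depth w"
  obtain t where "expands u (full ?j) = Some t" "expands v (full ?j) = Some t" "deep ?j t"
    using k[OF full_deep, of ?j] by auto
  moreover then obtain t' where "expands w t = Some t'"
    using expands_deep[of t ?j w] by auto
  ultimately have "expands (u @ w) (full ?j) = Some t'" "expands (v @ w) (full ?j) = Some t'"
    by (simp_all add: expands_append)
  then show ?thesis unfolding same_effect_def by blast
qed

lemma same_effect_cancel: "\<alpha> # u \<approx> \<alpha> # v \<Longrightarrow> u \<approx> v"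
  by (auto simp: same_effect_def split: bind_splits)

text \<open>The Ore condition: confluence, applied to the results of both words on a complete
  tree.\<close>

lemma common_right_multiple: "\<exists>c d. u @ c \<approx> v @ d"
proof -
  let ?k = "word_depth u + word_depth v"
  obtain a b where ab: "expands u (full ?k) = Some a" "expands v (full ?k) = Some b"
    using expands_deep[OF full_deep, of u ?k] expands_deep[OF full_deep, of v ?k] by auto
  obtain t where "a \<leadsto> t" "b \<leadsto> t"
    using confluent[of "full ?k" a b] ab by (auto simp: leads_to_def)
  then obtain c d where "expands c a = Some t" "expands d b = Some t"
    by (auto simp: leads_to_def)
  then have "expands (u @ c) (full ?k) = Some t" "expands (v @ d) (full ?k) = Some t"
    using ab by (simp_all add: expands_append)
  then show ?thesis unfolding same_effect_def by blast
qed

section \<open>Displacement along the left branch\<close>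

text \<open>\<open>dilate u i\<close> is the depth on the left branch of \<open>t \<cdot> u\<close> at which an expansion of the
  left subterm of \<open>t\<close> at depth \<open>i\<close> is found.\<close>

fun dilate :: "address list \<Rightarrow> nat \<Rightarrow> nat" where
  "dilate [] i = i"
| "dilate (\<alpha> # u) i = dilate u (if length \<alpha> < i \<and> True \<notin> set \<alpha> then Suc i else i)"

lemma dilate_strict_mono: "i < j \<Longrightarrow> dilate u i < dilate u j"
proof (induction u arbitrary: i j)
  case (Cons \<alpha> u)
  show ?case by (auto intro!: Cons.IH simp: Cons.prems) (use Cons.prems in linarith)+
qed simp

lemma dilate_not_root: "\<alpha> \<noteq> [] \<Longrightarrow> dilate (\<alpha> # u) 1 = dilate u 1"
  by auto

lemma dilate_root: "dilate u 1 < dilate ([] # u) 1"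
  by (simp add: dilate_strict_mono)

fun left :: "nat \<Rightarrow> cd_term \<Rightarrow> cd_term option" where
  "left 0 t = Some t"
| "left (Suc i) (App s t) = left i s"
| "left (Suc i) (Var n) = None"

text \<open>An expansion at a proper ancestor on the left branch pushes the chosen subterm one level
  down. At any other address it acts inside that subterm, which stays in its class, or off the
  branch.\<close>

lemma expand_left:
  "\<lbrakk>expand \<alpha> t = Some t'; left i t = Some s\<rbrakk> \<Longrightarrow>
    \<exists>s'. left (if length \<alpha> < i \<and> True \<notin> set \<alpha> then Suc i else i) t' = Some s' \<and> s =\<^bsub>CD\<^esub> s'"
proof (induction \<alpha> t arbitrary: t' i rule: expand.induct)
  case (1 a b c)
  then show ?case by (cases i) (auto intro: cd_eq_base)
next
  case (2 \<alpha> a b)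
  then obtain a' where a': "expand \<alpha> a = Some a'" "t' = App a' b" by auto
  show ?case
  proof (cases i)
    case 0
    then show ?thesis using 2 a' by (auto intro!: cd_eq_cong intro: expand_cd_eq)
  next
    case (Suc j)
    then have "left j a = Some s" using 2 by simp
    from "2.IH"[OF a'(1) this] show ?thesis by (auto simp: Suc a' split: if_splits)
  qed
next
  case (3 \<alpha> a b)
  then show ?case by (cases i) (auto intro!: cd_eq_cong intro: expand_cd_eq)
qed auto

lemma expands_left:
  "\<lbrakk>expands u t = Some t'; left i t = Some s\<rbrakk> \<Longrightarrow>
    \<exists>s'. left (dilate u i) t' = Some s' \<and> s =\<^bsub>CD\<^esub> s'"
proof (induction u arbitrary: t i s)
  case (Cons \<alpha> u)
  then obtain t1 where t1: "expand \<alpha> t = Some t1" "expands u t1 = Some t'"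
    by (auto split: bind_splits)
  obtain s1 where s1: "left (if length \<alpha> < i \<and> True \<notin> set \<alpha> then Suc i else i) t1 = Some s1" "s =\<^bsub>CD\<^esub> s1"
    using expand_left[OF t1(1) Cons.prems(2)] by blast
  from Cons.IH[OF t1(2) s1(1)] s1(2) show ?case
    using cd_eq_trans by auto
qed simp

text \<open>Consequently a CD-class occurs at most once on the left branch of a term, and the class
  determines the depth.\<close>

lemma left_nf_less: "\<lbrakk>left i t = Some a; left j t = Some b; i < j\<rbrakk> \<Longrightarrow> nf b \<prec> nf a"
proof -
  have down: "left (Suc k) t = Some c \<Longrightarrow> nf c \<prec> nf t" for k t c
  proof (induction k arbitrary: t)
    case 0
    then show ?case using nf_App_left by (cases t) auto
  next
    case (Suc k)
    then obtain s s' where t: "t = App s s'" by (cases t) auto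
    then have "nf c \<prec> nf s" using Suc by simp
    then show ?case using nf_App_left[of s s'] ldiv_trans unfolding t by blast
  qed
  show "\<lbrakk>left i t = Some a; left j t = Some b; i < j\<rbrakk> \<Longrightarrow> nf b \<prec> nf a"
  proof (induction i arbitrary: t j)
    case 0
    then show ?case using down by (cases j) auto
  next
    case (Suc i)
    then show ?case by (cases t; cases j) auto
  qed
qed

text \<open>In the common result both numbers are depths of a left subterm equivalent to the
  original one; such a depth is unique.\<close>

lemma same_effect_dilate:
  assumes "u \<approx> v"
  shows "dilate u 1 = dilate v 1"
proof -
  obtain k where k: "\<And>s j. \<lbrakk>deep j s; k \<le> j\<rbrakk> \<Longrightarrow> \<exists>s'. expands u s = Some s' \<and> expands v s = Some s' \<and> deep j s'"
    using same_effect_deep[OF assms] by blast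
  obtain t' where t': "expands u (full (Suc k)) = Some t'" "expands v (full (Suc k)) = Some t'"
    using k[OF full_deep, of "Suc k"] by auto
  have l: "left 1 (full (Suc k)) = Some (full k)" by (simp add: full.simps)
  obtain a b where a: "left (dilate u 1) t' = Some a" "full k =\<^bsub>CD\<^esub> a"
    and b: "left (dilate v 1) t' = Some b" "full k =\<^bsub>CD\<^esub> b"
    using expands_left[OF t'(1) l] expands_left[OF t'(2) l] by blast
  have "nf a = nf b" using a(2) b(2) nf_cong by metis
  then show ?thesis
    using left_nf_less[OF a(1) b(1)] left_nf_less[OF b(1) a(1)] ldiv_irrefl reduced_nf
    by (metis linorder_neqE_nat)
qed


section \<open>Words that do not represent the identity\<close>

lemma same_effect_prefix:
  assumes "u \<approx> v"
  shows "map ((@) \<gamma>) u \<approx> map ((@) \<gamma>) v"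
proof (induction \<gamma>)
  case Nil
  then show ?case using assms by (simp add: map_idI)
next
  case (Cons x \<gamma>)
  then obtain t t' where t: "expands (map ((@) \<gamma>) u) t = Some t'" "expands (map ((@) \<gamma>) v) t = Some t'"
    by (auto simp: same_effect_def)
  have eq: "map ((@) (x # \<gamma>)) w = map ((#) x) (map ((@) \<gamma>) w)" for w :: "address list"
    by simp
  have "\<exists>s'. expands (map ((#) x) (map ((@) \<gamma>) u)) (App t t) = Some s' \<and>
    expands (map ((#) x) (map ((@) \<gamma>) v)) (App t t) = Some s'"
    using t by (cases x) (simp_all add: expands_shift_left expands_shift_right del: map_map)
  then show ?case unfolding eq by (auto simp del: map_map intro: same_effectI)
qed

text \<open>Each relation is verified with empty \<gamma> on one sufficiently large tree and then
  moved below \<gamma>.\<close>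

lemma R_CD_same_effect:
  assumes "(u, v) \<in> R_CD"
  obtains p q where "u = positive p" "v = positive q" "p \<approx> q"
proof -
  have ex: "\<exists>a. expand \<alpha> (full (length \<alpha> + length \<beta> + 2)) = Some a" for \<alpha> \<beta> :: address
    using expand_deep[OF full_deep, of \<alpha> "length \<alpha> + length \<beta> + 2"] by auto
  from assms show thesis
  proof cases
    case (R_CD_perp \<gamma> \<alpha> \<beta>)
    let ?f = "full (length \<alpha> + length \<beta> + 2)"
    have "[False # \<alpha>, True # \<beta>] \<approx> [True # \<beta>, False # \<alpha>]"
      using ex[of \<alpha> \<beta>] ex[of \<beta> \<alpha>]
      by (auto simp: add.commute intro: same_effectI[of _ "App ?f ?f"])
    from same_effect_prefix[OF this, of \<gamma>] R_CD_perp show ?thesis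
      by (intro that) simp_all
  next
    case (R_CD_zero \<gamma> \<alpha>)
    let ?f = "full (length \<alpha> + length \<alpha> + 2)"
    have "[False # \<alpha>, []] \<approx> [[], False # False # \<alpha>]"
      using ex[of \<alpha> \<alpha>] by (auto intro: same_effectI[of _ "App ?f (App ?f ?f)"])
    from same_effect_prefix[OF this, of \<gamma>] R_CD_zero show ?thesis
      by (intro that) simp_all
  next
    case (R_CD_one_zero \<gamma> \<alpha>)
    let ?f = "full (length \<alpha> + length \<alpha> + 2)"
    have "[True # False # \<alpha>, []] \<approx> [[], False # True # \<alpha>, True # False # \<alpha>]"
      using ex[of \<alpha> \<alpha>] by (auto intro: same_effectI[of _ "App ?f (App ?f ?f)"])
    from same_effect_prefix[OF this, of \<gamma>] R_CD_one_zero show ?thesis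
      by (intro that) simp_all
  next
    case (R_CD_one_one \<gamma> \<alpha>)
    let ?f = "full (length \<alpha> + length \<alpha> + 2)"
    have "[True # True # \<alpha>, []] \<approx> [[], True # True # \<alpha>]"
      using ex[of \<alpha> \<alpha>] by (auto intro: same_effectI[of _ "App ?f (App ?f ?f)"])
    from same_effect_prefix[OF this, of \<gamma>] R_CD_one_one show ?thesis
      by (intro that) simp_all
  next
    case (R_CD_one \<gamma>)
    let ?f = "full 0"
    have "[[True], [], [False]] \<approx> [[], [True], []]"
      by (rule same_effectI[of _ "App ?f (App ?f (App ?f ?f))"]) simp_all
    from same_effect_prefix[OF this, of \<gamma>] R_CD_one show ?thesis
      by (intro that) simp_all
  qed
qed

section \<open>Signed words read through positive elements\<close>

text \<open>\<open>path w u v\<close>: the equality \<open>u = w v\<close> can be read off letter by letter, all intermediate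
  elements being positive.\<close>

fun path :: "address signed_word \<Rightarrow> address list \<Rightarrow> address list \<Rightarrow> bool" where
  "path [] u v \<longleftrightarrow> u \<approx> v"
| "path ((\<alpha>, True) # w) u v \<longleftrightarrow> (\<exists>u'. u \<approx> \<alpha> # u' \<and> path w u' v)"
| "path ((\<alpha>, False) # w) u v \<longleftrightarrow> path w (\<alpha> # u) v"

lemma path_cong_left: "\<lbrakk>path w u v; u' \<approx> u\<rbrakk> \<Longrightarrow> path w u' v"
proof (induction w u v arbitrary: u' rule: path.induct)
  case (1 u v)
  then show ?case using same_effect_trans by auto
next
  case (2 \<alpha> w u v)
  then obtain z where "u \<approx> \<alpha> # z" "path w z v" by auto
  then show ?case using same_effect_trans[OF 2(3)] by auto
next
  case (3 \<alpha> w u v)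
  then show ?case using same_effect_Cons by simp
qed

lemma path_append: "path (w @ x) u v \<longleftrightarrow> (\<exists>z. path w u z \<and> path x z v)"
proof (induction w u v rule: path.induct)
  case (1 u v)
  then show ?case using path_cong_left by auto
qed auto

lemma path_cong_right: "\<lbrakk>path w u v; v \<approx> v'\<rbrakk> \<Longrightarrow> path w u v'"
  using path_append[of w "[]" u v'] by auto

lemma path_extend: "path w u v \<Longrightarrow> path w (u @ d) (v @ d)"
proof (induction w u v rule: path.induct)
  case (2 \<alpha> w u v)
  then show ?case using same_effect_append_right by fastforce
qed (use same_effect_append_right in auto)

lemma path_positive: "path (positive p) u v \<longleftrightarrow> u \<approx> p @ v"
proof (induction p arbitrary: u)
  case (Cons \<alpha> p)
  show ?case
  proof
    assume "path (positive (\<alpha> # p)) u v"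
    then obtain z where "u \<approx> \<alpha> # z" "z \<approx> p @ v" using Cons by auto
    then show "u \<approx> (\<alpha> # p) @ v" using same_effect_trans[OF _ same_effect_Cons] by simp
  next
    assume "u \<approx> (\<alpha> # p) @ v"
    then show "path (positive (\<alpha> # p)) u v" using Cons by auto
  qed
qed simp

text \<open>The two halves may call for different right extensions \<open>d\<close> and
  \<open>e\<close>; a common right multiple aligns them at the middle element.\<close>

lemma path_append_transfer:
  assumes w: "\<And>u v. path w u v \<Longrightarrow> \<exists>d. path w' (u @ d) (v @ d)"
    and x: "\<And>u v. path x u v \<Longrightarrow> \<exists>d. path x' (u @ d) (v @ d)"
    and p: "path (w @ x) u v"
  shows "\<exists>d. path (w' @ x') (u @ d) (v @ d)"
proof -
  obtain z where z: "path w u z" "path x z v" using p path_append by auto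
  obtain d e where d: "path w' (u @ d) (z @ d)" and e: "path x' (z @ e) (v @ e)"
    using w[OF z(1)] x[OF z(2)] by auto
  obtain d' e' where de: "d @ d' \<approx> e @ e'" using common_right_multiple by blast
  have "path w' (u @ d @ d') (z @ d @ d')" "path x' (z @ e @ e') (v @ e @ e')"
    using path_extend[OF d, of d'] path_extend[OF e, of e'] by simp_all
  moreover have "z @ d @ d' \<approx> z @ e @ e'" "v @ e @ e' \<approx> v @ d @ d'"
    using de same_effect_sym same_effect_append_left by blast+
  ultimately have "path (w' @ x') (u @ d @ d') (v @ d @ d')"
    using path_cong_right[of x'] path_cong_left[of x' "z @ e @ e'" "v @ d @ d'" "z @ d @ d'"]
    unfolding path_append by blast
  then show ?thesis by blast
qed

text \<open>Deleting a cancelling pair uses left cancellation; inserting one may need a right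
  extension. Both directions are carried together so that symmetry is trivial.\<close>

lemma path_word_rel:
  "(w, w') \<in> word_rel R_CD \<Longrightarrow>
    (\<forall>u v. path w u v \<longrightarrow> (\<exists>d. path w' (u @ d) (v @ d))) \<and>
    (\<forall>u v. path w' u v \<longrightarrow> (\<exists>d. path w (u @ d) (v @ d)))"
proof (induction rule: word_rel.induct)
  case (word_rel_rel w w')
  then obtain p q where pq: "w = positive p" "w' = positive q" "p \<approx> q"
    by (rule R_CD_same_effect)
  have "p @ v \<approx> q @ v" "q @ v \<approx> p @ v" for v
    using pq same_effect_append_right same_effect_sym by blast+
  then have "path w u v \<longleftrightarrow> path w' u v" for u v
    unfolding pq path_positive using same_effect_trans[of u "p @ v" "q @ v"]
      same_effect_trans[of u "q @ v" "p @ v"] by blast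
  then show ?case using path_extend by blast
next
  case (word_rel_cancel \<alpha> e)
  show ?case
  proof (intro conjI allI impI)
    fix u v
    assume p: "path [(\<alpha>, e), (\<alpha>, \<not> e)] u v"
    then have "path [] u v"
    proof (cases e)
      case True
      with p obtain u' where "u \<approx> \<alpha> # u'" "\<alpha> # u' \<approx> v" by auto
      then show ?thesis using same_effect_trans by simp
    next
      case False
      with p obtain u' where "\<alpha> # u \<approx> \<alpha> # u'" "u' \<approx> v" by auto
      then show ?thesis using same_effect_trans[OF same_effect_cancel] by simp
    qed
    then show "\<exists>d. path [] (u @ d) (v @ d)" using path_extend by blast
  next
    fix u v
    assume "path [] u v"
    then have uv: "u \<approx> v" by simp
    show "\<exists>d. path [(\<alpha>, e), (\<alpha>, \<not> e)] (u @ d) (v @ d)"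
    proof (cases e)
      case True
      \<comment> \<open>The letter \<alpha> can be removed only after \<open>u\<close> is extended
        to a right multiple of it.\<close>
      obtain d c where dc: "u @ d \<approx> \<alpha> # c"
        using common_right_multiple[of u "[\<alpha>]"] by auto
      have "\<alpha> # c \<approx> v @ d"
        by (rule same_effect_trans[OF same_effect_sym[OF dc] same_effect_append_right[OF uv]])
      with dc show ?thesis using True by auto
    next
      case False
      have "\<alpha> # u @ [] \<approx> \<alpha> # v @ []" using uv same_effect_Cons by simp
      then have "path [(\<alpha>, e), (\<alpha>, \<not> e)] (u @ []) (v @ [])" using False by auto
      then show ?thesis by blast
    qed
  qed
next
  case (word_rel_refl w)
  show ?case using path_extend by blast
next
  case (word_rel_trans w w' w'')
  have "\<exists>d. path z (u @ d) (v @ d)"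
    if x: "path x u v" and xy: "\<forall>u v. path x u v \<longrightarrow> (\<exists>d. path y (u @ d) (v @ d))"
      and yz: "\<forall>u v. path y u v \<longrightarrow> (\<exists>d. path z (u @ d) (v @ d))" for x y z u v
  proof -
    obtain d where "path y (u @ d) (v @ d)" using x xy by blast
    then obtain e where "path z ((u @ d) @ e) ((v @ d) @ e)" using yz by blast
    then show ?thesis by (intro exI[of _ "d @ e"]) simp
  qed
  from this[of w _ _ w' w''] this[of w'' _ _ w' w] show ?case
    using word_rel_trans.IH by blast
next
  case (word_rel_cong w w' x x')
  then show ?case
    using path_append_transfer[of w w' x x'] path_append_transfer[of w' w x' x] by simp
next
  case (word_rel_sym w w')
  then show ?case by blast
qed

text \<open>Among all letters only the root moves the left subterm at depth 1. Letters at other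
  addresses keep the displacement, and each positive root letter read off lowers it.\<close>

lemma path_dilate:
  "\<lbrakk>path w u v; ([], False) \<notin> set w\<rbrakk> \<Longrightarrow>
    dilate v 1 \<le> dilate u 1 \<and> (([], True) \<in> set w \<longrightarrow> dilate v 1 < dilate u 1)"
proof (induction w u v rule: path.induct)
  case (1 u v)
  then show ?case using same_effect_dilate[of u v] by simp
next
  case (2 \<alpha> w u v)
  then obtain u' where u': "u \<approx> \<alpha> # u'" "path w u' v" by auto
  then have "dilate u 1 = dilate (\<alpha> # u') 1" by (intro same_effect_dilate)
  then have "dilate u' 1 \<le> dilate u 1 \<and> (\<alpha> = [] \<longrightarrow> dilate u' 1 < dilate u 1)"
    using dilate_root[of u'] dilate_not_root[of \<alpha> u'] by (cases "\<alpha> = []") (auto simp del: dilate.simps)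
  moreover have "dilate v 1 \<le> dilate u' 1 \<and> (([], True) \<in> set w \<longrightarrow> dilate v 1 < dilate u' 1)"
    using 2 u' by simp
  ultimately show ?case by auto
next
  case (3 \<alpha> w u v)
  then have "\<alpha> \<noteq> []" by auto
  with 3 show ?case using dilate_not_root[of \<alpha> u] by (simp del: dilate.simps)
qed

text \<open>The trivial path of the empty word would transfer to a path of \<open>w\<close> from
  some \<open>d\<close> to itself, contrary to the strict decrease.\<close>

theorem root_positive_not_one:
  assumes "([], False) \<notin> set w" "([], True) \<in> set w"
  shows "(w, []) \<notin> word_rel R_CD"
proof
  assume "(w, []) \<in> word_rel R_CD"
  moreover have "path [] [] []" by simp
  ultimately obtain d where "path w ([] @ d) ([] @ d)"
    using path_word_rel by blast
  then show False using path_dilate assms by blast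
qed


section \<open>The group and its cosets\<close>

interpretation G_CD: group G_CD
  by (rule group_G_CD)

interpretation sh1: group_hom G_CD G_CD sh1
  by unfold_locales (rule sh1_hom)

abbreviation G_mult (infixl "\<odot>" 70) where "x \<odot> y \<equiv> x \<otimes>\<^bsub>G_CD\<^esub> y"
abbreviation G_inv ("\<iota>") where "\<iota> x \<equiv> inv\<^bsub>G_CD\<^esub> x"
abbreviation word_class ("\<langle>_\<rangle>") where "\<langle>w\<rangle> \<equiv> word_rel R_CD `` {w}"

definition inv_word :: "'x signed_word \<Rightarrow> 'x signed_word" where
  "inv_word w = rev (map (map_prod id Not) w)"

lemma word_class_eq_iff: "\<langle>u\<rangle> = \<langle>v\<rangle> \<longleftrightarrow> (u, v) \<in> word_rel R_CD"
  by (simp add: eq_equiv_class_iff[OF equiv_word_rel])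

lemma inv_word_class: "\<iota> \<langle>w\<rangle> = \<langle>inv_word w\<rangle>"
proof -
  have "\<langle>w\<rangle> \<odot> \<langle>inv_word w\<rangle> = \<one>\<^bsub>G_CD\<^esub>"
    unfolding mult_G_CD one_G_CD word_class_eq_iff inv_word_def by (rule word_rel_inverse_right)
  then have "\<iota> \<langle>inv_word w\<rangle> = \<langle>w\<rangle>"
    by (rule G_CD.inv_equality) (rule class_in_G_CD)+
  then show ?thesis
    using G_CD.inv_inv[OF class_in_G_CD] by metis
qed

lemma gen_in_G_CD [simp, intro]: "gen_CD \<alpha> \<in> carrier G_CD"
  unfolding gen_CD_def by (rule class_in_G_CD)

lemma gen_inv: "\<iota> (gen_CD \<alpha>) = \<langle>[(\<alpha>, False)]\<rangle>"
  by (simp add: gen_CD_def inv_word_class inv_word_def)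

lemma G_CD_induct [consumes 1, case_names one gen inv mult]:
  assumes "x \<in> carrier G_CD" "P \<one>\<^bsub>G_CD\<^esub>" "\<And>\<alpha>. P (gen_CD \<alpha>)"
    and "\<And>x. \<lbrakk>x \<in> carrier G_CD; P x\<rbrakk> \<Longrightarrow> P (\<iota> x)"
    and "\<And>x y. \<lbrakk>x \<in> carrier G_CD; y \<in> carrier G_CD; P x; P y\<rbrakk> \<Longrightarrow> P (x \<odot> y)"
  shows "P x"
proof -
  have letter: "P \<langle>[(\<alpha>, e)]\<rangle>" for \<alpha> e
    using assms(3)[of \<alpha>] assms(4)[OF gen_in_G_CD assms(3), of \<alpha>]
    by (cases e) (simp_all add: gen_inv, simp add: gen_CD_def)
  have "P \<langle>w\<rangle>" for w
  proof (induction w)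
    case Nil
    show ?case using assms(2) by (simp add: one_G_CD)
  next
    case (Cons a w)
    have "P (\<langle>[a]\<rangle> \<odot> \<langle>w\<rangle>)"
      using letter by (intro assms(5) class_in_G_CD Cons) (cases a, simp)
    then show ?case by (simp add: mult_G_CD)
  qed
  then show ?thesis using assms(1) by (elim G_CD_cases) simp
qed

lemma inv_cancel_left [simp]:
  "\<lbrakk>x \<in> carrier G_CD; y \<in> carrier G_CD\<rbrakk> \<Longrightarrow> \<iota> x \<odot> (x \<odot> y) = y"
  "\<lbrakk>x \<in> carrier G_CD; y \<in> carrier G_CD\<rbrakk> \<Longrightarrow> x \<odot> (\<iota> x \<odot> y) = y"
  by (simp_all add: G_CD.m_assoc[symmetric])

lemma commute_inv:
  "\<lbrakk>x \<in> carrier G_CD; y \<in> carrier G_CD; x \<odot> y = y \<odot> x\<rbrakk> \<Longrightarrow> \<iota> x \<odot> y = y \<odot> \<iota> x"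
  by (simp add: G_CD.inv_solve_left' G_CD.m_assoc[symmetric])
     (simp add: G_CD.m_assoc)

lemma commute_mult:
  "\<lbrakk>x \<in> carrier G_CD; y \<in> carrier G_CD; z \<in> carrier G_CD; x \<odot> z = z \<odot> x; y \<odot> z = z \<odot> y\<rbrakk>
    \<Longrightarrow> (x \<odot> y) \<odot> z = z \<odot> (x \<odot> y)"
  by (metis G_CD.m_assoc)

lemma gen_relation:
  assumes "(positive p, positive q) \<in> R_CD"
  shows "\<langle>positive p\<rangle> = \<langle>positive q\<rangle>"
  unfolding word_class_eq_iff by (rule word_rel_rel[OF assms])

section \<open>The relations at the root and the subgroup \<open>G0\<close>\<close>

lemma gen_perp: "gen_CD (False # \<alpha>) \<odot> gen_CD (True # \<beta>) = gen_CD (True # \<beta>) \<odot> gen_CD (False # \<alpha>)"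
  using gen_relation[OF R_CD_perp[of "[]"]] by (simp add: gen_CD_def mult_G_CD)

lemma gen_zero: "gen_CD (False # \<alpha>) \<odot> gen_CD [] = gen_CD [] \<odot> gen_CD (False # False # \<alpha>)"
  using gen_relation[OF R_CD_zero[of "[]"]] by (simp add: gen_CD_def mult_G_CD)

lemma gen_one_zero: "gen_CD (True # False # \<alpha>) \<odot> gen_CD [] =
    gen_CD [] \<odot> gen_CD (False # True # \<alpha>) \<odot> gen_CD (True # False # \<alpha>)"
  using gen_relation[OF R_CD_one_zero[of "[]"]] by (simp add: gen_CD_def mult_G_CD)

lemma gen_one_one: "gen_CD (True # True # \<alpha>) \<odot> gen_CD [] = gen_CD [] \<odot> gen_CD (True # True # \<alpha>)"
  using gen_relation[OF R_CD_one_one[of "[]"]] by (simp add: gen_CD_def mult_G_CD)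

lemma gen_one: "gen_CD [True] \<odot> gen_CD [] \<odot> gen_CD [False] = gen_CD [] \<odot> gen_CD [True] \<odot> gen_CD []"
  using gen_relation[OF R_CD_one[of "[]"]] by (simp add: gen_CD_def mult_G_CD)

lemma subgroup_G0: "subgroup G0 G_CD"
  unfolding G0_def by (rule G_CD.generate_is_subgroup) auto

lemma G0_in_G_CD [simp, intro]: "k \<in> G0 \<Longrightarrow> k \<in> carrier G_CD"
  using subgroup.mem_carrier[OF subgroup_G0] .

lemma G0_inv [simp, intro]: "k \<in> G0 \<Longrightarrow> \<iota> k \<in> G0"
  using subgroup.m_inv_closed[OF subgroup_G0] .

lemma G0_mult [simp, intro]: "\<lbrakk>k \<in> G0; l \<in> G0\<rbrakk> \<Longrightarrow> k \<odot> l \<in> G0"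
  using subgroup.m_closed[OF subgroup_G0] .

lemma G0_one [simp, intro]: "\<one>\<^bsub>G_CD\<^esub> \<in> G0"
  using subgroup.one_closed[OF subgroup_G0] .

lemma gen_in_G0 [simp, intro]: "gen_CD (False # \<alpha>) \<in> G0"
  unfolding G0_def by (rule generate.incl) auto

lemma G0_induct [consumes 1, case_names one gen inv mult]:
  assumes "k \<in> G0" "P \<one>\<^bsub>G_CD\<^esub>" "\<And>\<alpha>. P (gen_CD (False # \<alpha>))"
    and "\<And>\<alpha>. P (gen_CD (False # \<alpha>)) \<Longrightarrow> P (\<iota> (gen_CD (False # \<alpha>)))"
    and "\<And>k l. \<lbrakk>k \<in> G0; l \<in> G0; P k; P l\<rbrakk> \<Longrightarrow> P (k \<odot> l)"
  shows "P k"
  using assms(1) unfolding G0_def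
proof (induction rule: generate.induct)
  case (incl h)
  then show ?case using assms(3) by auto
next
  case (inv h)
  then show ?case using assms(3,4) by auto
next
  case (eng h1 h2)
  then show ?case using assms(5) by (simp add: G0_def)
qed (rule assms(2))

lemma sh1_sh1_root:
  assumes "x \<in> carrier G_CD"
  shows "sh1 (sh1 x) \<odot> gen_CD [] = gen_CD [] \<odot> sh1 (sh1 x)"
  using assms
proof (induction rule: G_CD_induct)
  case (gen \<alpha>)
  then show ?case by (simp add: sh1_gen_CD gen_one_one)
next
  case (inv x)
  then show ?case by (simp add: commute_inv)
next
  case (mult x y)
  then show ?case by (simp add: commute_mult)
qed simp

text \<open>Addresses beginning with 0 and with 1 are disjoint, so their generators commute.\<close>

lemma G0_sh1_commute:
  assumes "k \<in> G0" "x \<in> carrier G_CD"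
  shows "k \<odot> sh1 x = sh1 x \<odot> k"
proof -
  have "gen_CD (False # \<alpha>) \<odot> sh1 x = sh1 x \<odot> gen_CD (False # \<alpha>)" for \<alpha>
    using assms(2)
  proof (induction rule: G_CD_induct)
    case (gen \<beta>)
    then show ?case by (simp add: sh1_gen_CD gen_perp)
  next
    case (inv x)
    then show ?case using commute_inv[of "sh1 x" "gen_CD (False # \<alpha>)"] by simp
  next
    case (mult x y)
    then show ?case using commute_mult[of "sh1 x" "sh1 y" "gen_CD (False # \<alpha>)"] by simp
  qed simp
  with assms(1) show ?thesis
  proof (induction rule: G0_induct)
    case one
    show ?case using assms(2) by simp
  next
    case (inv \<alpha>)
    then show ?case using assms(2) by (simp add: commute_inv)
  next
    case (mult k l)
    then show ?case using assms(2) by (simp add: commute_mult)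
  qed simp
qed

text \<open>Conjugation by the root generator sends the generator at 0\<alpha> to the one at
  00\<alpha>.\<close>

lemma G0_root:
  assumes "k \<in> G0"
  obtains k' where "k' \<in> G0" "k \<odot> gen_CD [] = gen_CD [] \<odot> k'"
proof -
  have "\<iota> (gen_CD []) \<odot> k \<odot> gen_CD [] \<in> G0"
    using assms
  proof (induction rule: G0_induct)
    case (gen \<alpha>)
    then show ?case by (simp add: G_CD.m_assoc gen_zero)
  next
    case (inv \<alpha>)
    then show ?case using G0_inv[OF inv] by (simp add: G_CD.m_assoc G_CD.inv_mult_group)
  next
    case (mult k l)
    then have "(\<iota> (gen_CD []) \<odot> k \<odot> gen_CD []) \<odot> (\<iota> (gen_CD []) \<odot> l \<odot> gen_CD []) \<in> G0"
      by blast
    then show ?case using mult by (simp add: G_CD.m_assoc)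
  qed simp
  then show thesis
    by (rule that) (use assms in \<open>simp add: G_CD.m_assoc\<close>)
qed

text \<open>On generators this is the relation for 10\<alpha>, with \<open>k'\<close> the generator
  at 01\<alpha>. It extends to all of \<open>G0\<close> because the defect \<open>d\<close> is
  multiplicative there.\<close>

lemma sh1_G0_root:
  assumes "k \<in> G0"
  obtains k' where "k' \<in> G0" "sh1 k \<odot> gen_CD [] \<odot> \<iota> (sh1 k) = gen_CD [] \<odot> k'"
proof -
  define d where "d k = \<iota> (gen_CD []) \<odot> sh1 k \<odot> gen_CD [] \<odot> \<iota> (sh1 k)" for k
  have mult: "d (k \<odot> l) = d k \<odot> d l" if "k \<in> carrier G_CD" "l \<in> carrier G_CD" "d l \<in> G0" for k l
  proof -
    have "d (k \<odot> l) = d k \<odot> (sh1 k \<odot> d l \<odot> \<iota> (sh1 k))"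
      using that by (simp add: d_def G_CD.m_assoc G_CD.inv_mult_group)
    \<comment> \<open>The value \<open>d l\<close> lies in \<open>G0\<close>, so conjugation by a
      shifted element does not change it.\<close>
    also have "sh1 k \<odot> d l = d l \<odot> sh1 k" using G0_sh1_commute that by simp
    finally show ?thesis using that by (simp add: G_CD.m_assoc)
  qed
  have "d k \<in> G0"
    using assms
  proof (induction rule: G0_induct)
    case one
    show ?case by (simp add: d_def)
  next
    case (gen \<alpha>)
    have "d (gen_CD (False # \<alpha>)) = gen_CD (False # True # \<alpha>)"
      by (simp add: d_def sh1_gen_CD G_CD.m_assoc) (simp add: G_CD.m_assoc[symmetric] gen_one_zero,
          simp add: G_CD.m_assoc)
    then show ?case by simp
  next
    case (inv \<alpha>)
    let ?x = "gen_CD (False # \<alpha>)"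
    have "d (\<iota> ?x) \<odot> d ?x = d (\<iota> ?x \<odot> ?x)"
      by (rule mult[symmetric]) (use inv in auto)
    also have "\<dots> = \<one>\<^bsub>G_CD\<^esub>" by (simp add: d_def)
    finally have "d (\<iota> ?x) = \<iota> (d ?x)"
      by (intro G_CD.inv_equality[symmetric]) (simp_all add: d_def)
    then show ?case using inv by simp
  next
    case (mult k l)
    then show ?case using \<open>\<And>k l. _ \<Longrightarrow> _ \<Longrightarrow> _ \<Longrightarrow> d (k \<odot> l) = d k \<odot> d l\<close> by simp
  qed
  then show thesis
    by (rule that) (use assms in \<open>simp add: d_def G_CD.m_assoc\<close>)
qed

section \<open>The induced operation on cosets\<close>

lemma coset_mult_G0: "\<lbrakk>x \<in> carrier G_CD; k \<in> G0\<rbrakk> \<Longrightarrow> (x \<odot> k) <#\<^bsub>G_CD\<^esub> G0 = x <#\<^bsub>G_CD\<^esub> G0"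
  by (rule G_CD.l_repr_independence[symmetric, OF _ _ subgroup_G0]) (auto simp: l_coset_def)

lemma coset_eqE:
  assumes "x <#\<^bsub>G_CD\<^esub> G0 = y <#\<^bsub>G_CD\<^esub> G0" "x \<in> carrier G_CD" "y \<in> carrier G_CD"
  obtains k where "k \<in> G0" "y = x \<odot> k"
proof -
  have "y \<in> x <#\<^bsub>G_CD\<^esub> G0" using G_CD.lcos_self[OF assms(3) subgroup_G0] assms(1) by simp
  then show thesis using that by (auto simp: l_coset_def)
qed

lemma star_closed [simp, intro]: "\<lbrakk>a \<in> carrier G_CD; b \<in> carrier G_CD\<rbrakk> \<Longrightarrow> a \<star> b \<in> carrier G_CD"
  by (simp add: star_CD_def)

text \<open>Both correcting factors are pushed to the right: \<open>h\<close> past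
  \<open>sh1 b\<close> and the root generator, \<open>k\<close> through its conjugation of that
  generator. What remains lies in \<open>G0\<close> and commutes with
  \<open>sh1 (\<iota> b)\<close>.\<close>

lemma star_coset_cong:
  assumes "a \<in> carrier G_CD" "b \<in> carrier G_CD" "h \<in> G0" "k \<in> G0"
  shows "((a \<odot> h) \<star> (b \<odot> k)) <#\<^bsub>G_CD\<^esub> G0 = (a \<star> b) <#\<^bsub>G_CD\<^esub> G0"
proof -
  obtain h' where h': "h' \<in> G0" "h \<odot> gen_CD [] = gen_CD [] \<odot> h'"
    using G0_root assms(3) by blast
  obtain k' where k': "k' \<in> G0" "sh1 k \<odot> gen_CD [] \<odot> \<iota> (sh1 k) = gen_CD [] \<odot> k'"
    using sh1_G0_root assms(4) by blast
  have "(a \<odot> h) \<star> (b \<odot> k) = a \<odot> (h \<odot> sh1 b) \<odot> (sh1 k \<odot> gen_CD [] \<odot> \<iota> (sh1 k)) \<odot> \<iota> (sh1 b)"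
    using assms by (simp add: star_CD_def G_CD.m_assoc G_CD.inv_mult_group)
  also have "\<dots> = a \<odot> sh1 b \<odot> (h \<odot> gen_CD []) \<odot> (k' \<odot> sh1 (\<iota> b))"
    unfolding k' using assms k' G0_sh1_commute[of h b] by (simp add: G_CD.m_assoc)
  also have "\<dots> = a \<odot> sh1 b \<odot> gen_CD [] \<odot> ((h' \<odot> k') \<odot> sh1 (\<iota> b))"
    unfolding h' using assms h' k' by (simp add: G_CD.m_assoc)
  also have "(h' \<odot> k') \<odot> sh1 (\<iota> b) = sh1 (\<iota> b) \<odot> (h' \<odot> k')"
    using assms h' k' by (intro G0_sh1_commute) auto
  also have "a \<odot> sh1 b \<odot> gen_CD [] \<odot> (sh1 (\<iota> b) \<odot> (h' \<odot> k')) = (a \<star> b) \<odot> (h' \<odot> k')"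
    using assms h' k' by (simp add: star_CD_def G_CD.m_assoc)
  finally show ?thesis using coset_mult_G0 assms h' k' by simp
qed

text \<open>In the group the identity holds only up to a right factor from \<open>G0\<close>, which
  disappears on cosets.\<close>

lemma star_cd:
  assumes "a \<in> carrier G_CD" "b \<in> carrier G_CD" "c \<in> carrier G_CD"
  shows "(a \<star> b) \<star> (b \<star> c) = (a \<star> (b \<star> c)) \<odot> gen_CD [False]"
proof -
  let ?g = "gen_CD []" and ?gl = "gen_CD [False]" and ?gr = "gen_CD [True]"
    and ?s = "sh1 b" and ?t = "sh1 (sh1 c)"
  have sbc: "sh1 (b \<star> c) = ?s \<odot> ?t \<odot> ?gr \<odot> \<iota> ?t"
    using assms by (simp add: star_CD_def sh1_gen_CD)
  have tg: "?t \<odot> ?g = ?g \<odot> ?t" using sh1_sh1_root assms by simp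
  \<comment> \<open>A doubly shifted element commutes with the root generator, so the inner
    conjugation by \<open>sh1 (sh1 c)\<close> vanishes.\<close>
  then have tg': "\<iota> ?t \<odot> ?g \<odot> ?t = ?g" using assms by (simp add: G_CD.m_assoc flip: tg)
  have z: "\<iota> (sh1 (b \<star> c)) \<odot> ?gl = ?gl \<odot> \<iota> (sh1 (b \<star> c))"
    using G0_sh1_commute[of ?gl "\<iota> (b \<star> c)"] assms by simp
  have bc: "\<iota> (sh1 (b \<star> c)) = ?t \<odot> (\<iota> ?gr \<odot> (\<iota> ?t \<odot> \<iota> ?s))"
    unfolding sbc using assms by (simp add: G_CD.m_assoc G_CD.inv_mult_group)
  have star: "x \<star> (b \<star> c) = x \<odot> ?s \<odot> ?t \<odot> ?gr \<odot> (\<iota> ?t \<odot> ?g \<odot> ?t) \<odot> \<iota> ?gr \<odot> \<iota> ?t \<odot> \<iota> ?s"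
    if x: "x \<in> carrier G_CD" for x
    using assms x by (simp add: star_CD_def[of x "b \<star> c"] sbc bc G_CD.m_assoc G_CD.inv_mult_group)
  have abc: "a \<star> (b \<star> c) = a \<odot> ?s \<odot> ?t \<odot> ?gr \<odot> (\<iota> ?t \<odot> ?g \<odot> ?t) \<odot> \<iota> ?gr \<odot> \<iota> ?t \<odot> \<iota> ?s"
    using assms(1) by (rule star)
  have abbc: "(a \<star> b) \<star> (b \<star> c) = a \<odot> ?s \<odot> (?g \<odot> ?t) \<odot> ?gr \<odot> (\<iota> ?t \<odot> ?g \<odot> ?t) \<odot> \<iota> ?gr \<odot> \<iota> ?t \<odot> \<iota> ?s"
    unfolding star[OF star_closed[OF assms(1,2)]] using assms by (simp add: star_CD_def[of a b] G_CD.m_assoc)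
  have "(a \<star> b) \<star> (b \<star> c) = a \<odot> ?s \<odot> ?t \<odot> (?g \<odot> ?gr \<odot> ?g) \<odot> \<iota> ?gr \<odot> \<iota> ?t \<odot> \<iota> ?s"
    unfolding abbc tg' tg[symmetric] using assms by (simp add: G_CD.m_assoc)
  \<comment> \<open>The relation for \<gamma>1 at the root turns the middle product into one ending
    in \<open>gen_CD [False]\<close>; all later factors are shifted, so this letter can be moved to
    the far right.\<close>
  also have "\<dots> = a \<odot> ?s \<odot> ?t \<odot> ?gr \<odot> ?g \<odot> (?gl \<odot> sh1 (\<iota> (gen_CD []) \<odot> \<iota> (sh1 c) \<odot> \<iota> b))"
    unfolding gen_one[symmetric] using assms by (simp add: G_CD.m_assoc sh1_gen_CD)
  also have "\<dots> = a \<odot> ?s \<odot> ?t \<odot> ?gr \<odot> ?g \<odot> (sh1 (\<iota> (gen_CD []) \<odot> \<iota> (sh1 c) \<odot> \<iota> b) \<odot> ?gl)"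
    using assms by (subst G0_sh1_commute) auto
  also have "\<dots> = (a \<star> (b \<star> c)) \<odot> ?gl"
    unfolding abc tg' using assms by (simp add: G_CD.m_assoc sh1_gen_CD)
  finally show ?thesis .
qed

definition coset_rep :: "address signed_word set set \<Rightarrow> address signed_word set" where
  "coset_rep X = (SOME a. a \<in> carrier G_CD \<and> X = a <#\<^bsub>G_CD\<^esub> G0)"

definition coset_star ::
  "address signed_word set set \<Rightarrow> address signed_word set set \<Rightarrow> address signed_word set set" where
  "coset_star X Y = (coset_rep X \<star> coset_rep Y) <#\<^bsub>G_CD\<^esub> G0"

lemma coset_star:
  assumes "a \<in> carrier G_CD" "b \<in> carrier G_CD"
  shows "coset_star (a <#\<^bsub>G_CD\<^esub> G0) (b <#\<^bsub>G_CD\<^esub> G0) = (a \<star> b) <#\<^bsub>G_CD\<^esub> G0"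
proof -
  have rep: "\<exists>k\<in>G0. coset_rep (x <#\<^bsub>G_CD\<^esub> G0) = x \<odot> k" if x: "x \<in> carrier G_CD" for x
  proof -
    have "coset_rep (x <#\<^bsub>G_CD\<^esub> G0) \<in> carrier G_CD \<and>
        x <#\<^bsub>G_CD\<^esub> G0 = coset_rep (x <#\<^bsub>G_CD\<^esub> G0) <#\<^bsub>G_CD\<^esub> G0"
      unfolding coset_rep_def by (rule someI[where x = x]) (use x in simp)
    then show ?thesis using x coset_eqE by metis
  qed
  then show ?thesis
    using assms star_coset_cong unfolding coset_star_def by metis
qed

lemma cosetE:
  assumes "X \<in> lcosets\<^bsub>G_CD\<^esub> G0"
  obtains a where "a \<in> carrier G_CD" "X = a <#\<^bsub>G_CD\<^esub> G0"
  using assms by (auto simp: LCOSETS_def)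

lemma cosetI: "a \<in> carrier G_CD \<Longrightarrow> a <#\<^bsub>G_CD\<^esub> G0 \<in> lcosets\<^bsub>G_CD\<^esub> G0"
  by (auto simp: LCOSETS_def)

lemma cd_system_cosets: "cd_system (lcosets\<^bsub>G_CD\<^esub> G0) coset_star"
  unfolding cd_system_def
proof (intro conjI ballI)
  fix X Y Z
  assume "X \<in> lcosets\<^bsub>G_CD\<^esub> G0" "Y \<in> lcosets\<^bsub>G_CD\<^esub> G0" "Z \<in> lcosets\<^bsub>G_CD\<^esub> G0"
  then obtain a b c where "a \<in> carrier G_CD" "X = a <#\<^bsub>G_CD\<^esub> G0"
    and "b \<in> carrier G_CD" "Y = b <#\<^bsub>G_CD\<^esub> G0" and "c \<in> carrier G_CD" "Z = c <#\<^bsub>G_CD\<^esub> G0"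
    by (elim cosetE) blast
  then show "coset_star X (coset_star Y Z) = coset_star (coset_star X Y) (coset_star Y Z)"
    by (simp add: coset_star star_cd coset_mult_G0)
qed (auto elim!: cosetE simp: coset_star intro!: cosetI)

section \<open>Acyclicity of left division on cosets\<close>

definition root_positive :: "address signed_word \<Rightarrow> bool" where
  "root_positive w \<longleftrightarrow> ([], False) \<notin> set w \<and> ([], True) \<in> set w"

lemma root_positive_append: "\<lbrakk>root_positive u; root_positive v\<rbrakk> \<Longrightarrow> root_positive (u @ v)"
  by (auto simp: root_positive_def)

lemma G0_word:
  assumes "k \<in> G0"
  obtains w where "k = \<langle>w\<rangle>" "[] \<notin> fst ` set w"
proof -
  have "\<exists>w. k = \<langle>w\<rangle> \<and> [] \<notin> fst ` set w"
    using assms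
  proof (induction rule: G0_induct)
    case one
    show ?case by (auto simp: one_G_CD)
  next
    case (gen \<alpha>)
    show ?case by (rule exI[of _ "[(False # \<alpha>, True)]"]) (simp add: gen_CD_def)
  next
    case (inv \<alpha>)
    show ?case by (rule exI[of _ "[(False # \<alpha>, False)]"]) (simp add: gen_inv)
  next
    case (mult k l)
    then obtain u v where "k = \<langle>u\<rangle>" "[] \<notin> fst ` set u" "l = \<langle>v\<rangle>" "[] \<notin> fst ` set v" by blast
    then show ?case by (intro exI[of _ "u @ v"]) (auto simp: mult_G_CD)
  qed
  then show thesis using that by blast
qed

text \<open>Elements of \<open>G0\<close> have words without root letters; multiplying by the
  inverse of such a word keeps root positivity and would give the identity.\<close>

lemma root_positive_not_G0:
  assumes "root_positive w"
  shows "\<langle>w\<rangle> \<notin> G0"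
proof
  assume "\<langle>w\<rangle> \<in> G0"
  then obtain v where v: "\<langle>w\<rangle> = \<langle>v\<rangle>" "[] \<notin> fst ` set v" by (rule G0_word)
  then have "\<langle>w\<rangle> \<odot> \<iota> \<langle>v\<rangle> = \<one>\<^bsub>G_CD\<^esub>" by (simp add: class_in_G_CD)
  then have "(w @ inv_word v, []) \<in> word_rel R_CD"
    unfolding inv_word_class mult_G_CD one_G_CD word_class_eq_iff .
  moreover have "([], False) \<notin> set (w @ inv_word v)" "([], True) \<in> set (w @ inv_word v)"
    using assms v(2) by (force simp: root_positive_def inv_word_def)+
  ultimately show False using root_positive_not_one by blast
qed

text \<open>In the conjugate of the root generator by a shifted element, all other letters have
  addresses beginning with 1.\<close>

lemma star_root_positive:
  assumes "a \<in> carrier G_CD" "b \<in> carrier G_CD"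
  obtains w where "a \<star> b = a \<odot> \<langle>w\<rangle>" "root_positive w"
proof -
  obtain u where u: "b = \<langle>u\<rangle>" using assms(2) by (rule G_CD_cases)
  let ?s = "map (map_prod ((@) [True]) id)"
  let ?w = "?s u @ [([], True)] @ ?s (inv_word u)"
  have "a \<star> b = a \<odot> \<langle>?w\<rangle>"
    unfolding star_CD_def u inv_word_class sh1_class gen_CD_def
    by (simp add: G_CD.m_assoc[OF assms(1)] class_in_G_CD mult_G_CD)
  moreover have "root_positive ?w" by (auto simp: root_positive_def)
  ultimately show thesis by (rule that)
qed

definition coset_step :: "address signed_word set set rel" where
  "coset_step = {(X, coset_star X Y) |X Y. X \<in> lcosets\<^bsub>G_CD\<^esub> G0 \<and> Y \<in> lcosets\<^bsub>G_CD\<^esub> G0}"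

theorem coset_step_acyclic: "acyclic coset_step"
proof (rule acyclicI, rule allI, rule notI)
  fix X
  \<comment> \<open>Along a chain one representative \<open>a\<close> of the starting coset is kept,
    and the words of the successive steps are concatenated.\<close>
  have "\<exists>a w. a \<in> carrier G_CD \<and> root_positive w \<and> Y = a <#\<^bsub>G_CD\<^esub> G0 \<and> Z = (a \<odot> \<langle>w\<rangle>) <#\<^bsub>G_CD\<^esub> G0"
    if "(Y, Z) \<in> coset_step\<^sup>+" for Y Z
    using that
  proof (induction rule: trancl_induct)
    case (base Z)
    then obtain a b where "a \<in> carrier G_CD" "Y = a <#\<^bsub>G_CD\<^esub> G0" "b \<in> carrier G_CD"
      "Z = coset_star Y (b <#\<^bsub>G_CD\<^esub> G0)"
      by (auto simp: coset_step_def elim!: cosetE)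
    moreover from this obtain w where "a \<star> b = a \<odot> \<langle>w\<rangle>" "root_positive w"
      using star_root_positive by blast
    ultimately show ?case by (auto simp: coset_star)
  next
    case (step Z Z')
    then obtain a w where a: "a \<in> carrier G_CD" "root_positive w" "Y = a <#\<^bsub>G_CD\<^esub> G0"
      and Z: "Z = (a \<odot> \<langle>w\<rangle>) <#\<^bsub>G_CD\<^esub> G0" by blast
    obtain b where b: "b \<in> carrier G_CD" "Z' = coset_star Z (b <#\<^bsub>G_CD\<^esub> G0)"
      using step by (auto simp: coset_step_def elim!: cosetE)
    have aw: "a \<odot> \<langle>w\<rangle> \<in> carrier G_CD" using a class_in_G_CD by simp
    obtain v where v: "(a \<odot> \<langle>w\<rangle>) \<star> b = a \<odot> \<langle>w\<rangle> \<odot> \<langle>v\<rangle>" "root_positive v"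
      using star_root_positive[OF aw b(1)] .
    have "Z' = (a \<odot> \<langle>w @ v\<rangle>) <#\<^bsub>G_CD\<^esub> G0"
      unfolding b(2) Z coset_star[OF aw b(1)] v(1)
      by (simp add: G_CD.m_assoc[OF a(1) class_in_G_CD class_in_G_CD] mult_G_CD)
    then show ?case using a v root_positive_append by blast
  qed
  moreover assume "(X, X) \<in> coset_step\<^sup>+"
  ultimately obtain a w where a: "a \<in> carrier G_CD" "root_positive w"
    and eq: "a <#\<^bsub>G_CD\<^esub> G0 = (a \<odot> \<langle>w\<rangle>) <#\<^bsub>G_CD\<^esub> G0" by blast
  obtain k where k: "k \<in> G0" "a \<odot> \<langle>w\<rangle> = a \<odot> k"
    using coset_eqE[OF eq a(1)] a(1) class_in_G_CD by auto
  then have "\<langle>w\<rangle> = k" using a(1) class_in_G_CD by simp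
  then show False using root_positive_not_G0 a(2) k(1) by blast
qed


section \<open>Monogenic subsystems\<close>

fun eval_term :: "('a \<Rightarrow> 'a \<Rightarrow> 'a) \<Rightarrow> 'a \<Rightarrow> cd_term \<Rightarrow> 'a" where
  "eval_term op x (Var i) = x"
| "eval_term op x (App s t) = op (eval_term op x s) (eval_term op x t)"

lemma eval_skel: "eval_term op x (skel t) = eval_term op x t"
  by (induction t) auto

lemma eval_closed: "\<lbrakk>cd_system T op; x \<in> T\<rbrakk> \<Longrightarrow> eval_term op x t \<in> T"
  by (induction t) (auto simp: cd_system_def)

lemma eval_cd_eq:
  assumes "s =\<^bsub>CD\<^esub> t" "cd_system T op" "x \<in> T"
  shows "eval_term op x s = eval_term op x t"
  using assms(1)
proof (induction rule: cd_eq.induct)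
  case (cd_eq_base t0 t1 t2)
  then show ?case using eval_closed[OF assms(2,3)] assms(2) by (simp add: cd_system_def)
qed auto

lemma ldiv_eval:
  assumes "cd_system S op" "x \<in> S" "s \<prec> t"
  shows "(eval_term op x s, eval_term op x t) \<in> {(a, op a b) |a b. a \<in> S \<and> b \<in> S}\<^sup>+"
proof -
  have lstep: "(eval_term op x a, eval_term op x b) \<in> {(a, op a b) |a b. a \<in> S \<and> b \<in> S}"
    if ab: "(a, b) \<in> ldiv1" for a b
  proof -
    obtain c where "App a c =\<^bsub>CD\<^esub> b" using ab by (auto simp: ldiv1_def)
    from eval_cd_eq[OF this assms(1,2)]
    have "eval_term op x b = op (eval_term op x a) (eval_term op x c)" by simp
    then show ?thesis
      using eval_closed[OF assms(1,2), of a] eval_closed[OF assms(1,2), of c] by blast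
  qed
  from ldiv_trancl[OF assms(3)] show ?thesis
  proof (induction rule: trancl_induct)
    case (base t)
    then show ?case by (intro r_into_trancl lstep)
  next
    case (step t u)
    from step.IH lstep[OF step.hyps(2)] show ?case by (rule trancl_into_trancl)
  qed
qed

text \<open>If the normal forms of the skeletons differed, linearity would put one below the other,
  and evaluation would turn this into a cycle of left divisions.\<close>

lemma eval_inj:
  assumes "cd_system S op" "x \<in> S" "acyclic {(a, op a b) |a b. a \<in> S \<and> b \<in> S}"
    and eq: "eval_term op x s = eval_term op x t"
  shows "skel s =\<^bsub>CD\<^esub> skel t"
proof -
  have "eval_term op x (nf (skel s)) = eval_term op x (nf (skel t))"
    using eq eval_cd_eq[OF nf_cd_eq assms(1,2)] by (simp add: eval_skel)
  then have "\<not> nf (skel s) \<prec> nf (skel t)" "\<not> nf (skel t) \<prec> nf (skel s)"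
    using ldiv_eval[OF assms(1,2), of "nf (skel s)" "nf (skel t)"]
      ldiv_eval[OF assms(1,2), of "nf (skel t)" "nf (skel s)"] assms(3)
    unfolding acyclic_def by auto
  then have "nf (skel s) = nf (skel t)" using one_variable_total[of "skel s" "skel t"] by simp
  then show ?thesis by (simp add: cd_eq_iff_nf)
qed

lemma cd_generate_eval: "cd_generate op {x} = range (eval_term op x)"
proof (intro equalityI subsetI)
  fix y
  assume "y \<in> cd_generate op {x}"
  then show "y \<in> range (eval_term op x)"
  proof induction
    case (incl y)
    then show ?case by (auto intro: range_eqI[of _ _ "Var 0"])
  next
    case (closed y z)
    then show ?case by (auto intro: range_eqI[of _ _ "App _ _"])
  qed
next
  fix y
  assume "y \<in> range (eval_term op x)"
  moreover have "eval_term op x t \<in> cd_generate op {x}" for t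
    by (induction t) (auto intro: cd_generate.intros)
  ultimately show "y \<in> cd_generate op {x}" by auto
qed

theorem monogenic_free:
  assumes S: "cd_system S op" "x \<in> S" and acyclic: "acyclic {(a, op a b) |a b. a \<in> S \<and> b \<in> S}"
  shows "free_cd_system_on TYPE('b) (cd_generate op {x}) op {x}"
  unfolding free_cd_system_on_def
proof (intro conjI allI impI ballI)
  have sub: "cd_generate op {x} \<subseteq> S"
    using eval_closed[OF S] by (auto simp: cd_generate_eval)
  show "cd_system (cd_generate op {x}) op"
    using S(1) sub cd_generate.closed unfolding cd_system_def by (metis subsetD)
  show "{x} \<subseteq> cd_generate op {x}" by (auto intro: cd_generate.incl)
  fix T :: "'b set" and op' f
  assume T: "cd_system T op'" and f: "f \<in> {x} \<rightarrow> T"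
  then have fx: "f x \<in> T" by auto
  let ?C = "cd_generate op {x}"
  \<comment> \<open>An arbitrary term is chosen for each element; by \<open>eval_inj\<close> two
    choices have CD-equivalent skeletons, hence equal values in the target.\<close>
  define h where "h y = (if y \<in> ?C then eval_term op' (f x) (SOME t. eval_term op x t = y) else undefined)" for y
  have h_eval: "h (eval_term op x t) = eval_term op' (f x) t" for t
  proof -
    let ?s = "SOME s. eval_term op x s = eval_term op x t"
    have "eval_term op x ?s = eval_term op x t" by (rule someI) simp
    then have "skel ?s =\<^bsub>CD\<^esub> skel t" by (rule eval_inj[OF S acyclic])
    then have "eval_term op' (f x) ?s = eval_term op' (f x) t"
      using eval_cd_eq[OF _ T fx] by (metis eval_skel)
    then show ?thesis by (simp add: h_def cd_generate_eval)
  qed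
  show "\<exists>!h. h \<in> cd_hom ?C op T op' \<inter> extensional ?C \<and> (\<forall>b\<in>{x}. h b = f b)"
  proof (rule ex1I[of _ h])
    have "h (op y z) = op' (h y) (h z)" if yz: "y \<in> ?C" "z \<in> ?C" for y z
    proof -
      obtain s t where "y = eval_term op x s" "z = eval_term op x t"
        using yz by (auto simp: cd_generate_eval)
      then show ?thesis using h_eval[of "App s t"] by (simp add: h_eval)
    qed
    moreover have "h \<in> ?C \<rightarrow> T"
      using h_eval eval_closed[OF T fx] by (auto simp: cd_generate_eval)
    moreover have "h x = f x" using h_eval[of "Var 0"] by simp
    moreover have "h \<in> extensional ?C" by (auto simp: h_def extensional_def)
    ultimately show "h \<in> cd_hom ?C op T op' \<inter> extensional ?C \<and> (\<forall>b\<in>{x}. h b = f b)"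
      by (auto simp: cd_hom_def)
  next
    fix h'
    assume h': "h' \<in> cd_hom ?C op T op' \<inter> extensional ?C \<and> (\<forall>b\<in>{x}. h' b = f b)"
    have "h' (eval_term op x t) = eval_term op' (f x) t" for t
    proof (induction t)
      case (App s t)
      then show ?case using h' by (auto simp: cd_hom_def cd_generate_eval)
    qed (use h' in auto)
    then have "h' y = h y" if "y \<in> ?C" for y
      using that h_eval by (auto simp: cd_generate_eval)
    moreover have "h' y = h y" if "y \<notin> ?C" for y
      using that h' by (auto simp: h_def extensional_def)
    ultimately show "h' = h" by blast
  qed
qed


section \<open>The word problem and the coset system\<close>

theorem mainTheorem1:
  shows "(\<exists>f. prim_rec 2 f \<and>
            (\<forall>t t'. f [term_code t, term_code t'] = (if t =\<^bsub>CD\<^esub> t' then 1 else 0))) \<and>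
         (\<exists>op.
            (\<forall>a \<in> carrier G_CD. \<forall>b \<in> carrier G_CD.
               op (a <#\<^bsub>G_CD\<^esub> G0) (b <#\<^bsub>G_CD\<^esub> G0) = (a \<star> b) <#\<^bsub>G_CD\<^esub> G0) \<and>
            cd_system (lcosets\<^bsub>G_CD\<^esub> G0) op \<and>
            (\<forall>X \<in> lcosets\<^bsub>G_CD\<^esub> G0.
               free_cd_system_on TYPE('b) (cd_generate op {X}) op {X}))"
proof (intro conjI exI[of _ coset_star] ballI)
  show "\<exists>f. prim_rec 2 f \<and>
      (\<forall>t t'. f [term_code t, term_code t'] = (if t =\<^bsub>CD\<^esub> t' then 1 else 0))"
    by (rule cd_eq_prim_rec)
  show "coset_star (a <#\<^bsub>G_CD\<^esub> G0) (b <#\<^bsub>G_CD\<^esub> G0) = (a \<star> b) <#\<^bsub>G_CD\<^esub> G0"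
    if "a \<in> carrier G_CD" "b \<in> carrier G_CD" for a b
    using that by (rule coset_star)
  show "cd_system (lcosets\<^bsub>G_CD\<^esub> G0) coset_star"
    by (rule cd_system_cosets)
  show "free_cd_system_on TYPE('b) (cd_generate coset_star {X}) coset_star {X}"
    if "X \<in> lcosets\<^bsub>G_CD\<^esub> G0" for X
    using cd_system_cosets that coset_step_acyclic[unfolded coset_step_def]
    by (rule monogenic_free)
qed

end
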